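(* Rational Łukasiewicz logic $\mathbf{R}\text{Ł}$ has no proper consistent extensions, and therefore it is hereditarily structurally complete.
   Context: A BL-algebra is an algebra $\langle A;\wedge,\vee,\cdot,\to,0,1\rangle$ such that $\langle A;\wedge,\vee,0,1\rangle$ is a bounded lattice, $\langle A;\cdot,1\rangle$ is a commutative monoid, $a\cdot b\le c\iff a\le b\to c$, $(a\to c)\vee(c\to a)=1$ and $a\wedge c=a\cdot(a\to c)$. The standard MV-algebra $[0,1]_{\text{Ł}}$ is the BL-algebra on the real $[0,1]$ with usual order, $a\cdot c=\max\{0,a+c-1\}$ and $a\to c=\min\{1,1-a+c\}$; MV-algebras are the members of the variety it generates. With new constants $\{\mathbf{c}_q:q\in[0,1]\cap\mathbb{Q}\}$, a rational MV-algebra is an algebra in the BL language expanded by these constants whose BL-reduct is an MV-algebra and satisfying $\mathbf{c}_p\cdot\mathbf{c}_q\approx\mathbf{c}_{p\cdot q}$, $\mathbf{c}_p\to\mathbf{c}_q\approx\mathbf{c}_{p\to q}$ (computed in $[0,1]_{\text{Ł}}$), $\mathbf{c}_0\approx0$, $\mathbf{c}_1\approx1$; $\mathsf{RMV}$ is their variety. Rational Łukasiewicz logic $\mathbf{R}\text{Ł}$: $\Gamma\vdash\varphi$ iff for some finite $\Delta\subseteq\Gamma$, $\{\delta\approx1:\delta\in\Delta\}\models_{\mathsf{RMV}}\varphi\approx1$. Logics are finitary substitution-invariant consequence relations; an extension is such a relation on the same formulas containing the given one; it is consistent if not every formula is a theorem. A rule $\Gamma\rhd\varphi$ (finite $\Gamma$)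 is derivable in $\vdash$ if $\Gamma\vdash\varphi$ and admissible if for every substitution $\sigma$, $\emptyset\vdash\sigma(\gamma)$ for all $\gamma\in\Gamma$ implies $\emptyset\vdash\sigma(\varphi)$; $\vdash$ is structurally complete if every admissible rule is derivable, and hereditarily structurally complete if all its extensions are structurally complete. *)

theory Defs
  imports Complex_Main "HOL-Algebra.Group" "HOL-Library.Countable"
begin

section \<open>BL-algebras and MV-algebras\<close>

record 'a bl = "'a monoid" +
  bl_meet :: "'a \<Rightarrow> 'a \<Rightarrow> 'a"
  bl_join :: "'a \<Rightarrow> 'a \<Rightarrow> 'a"
  bl_imp  :: "'a \<Rightarrow> 'a \<Rightarrow> 'a"
  bl_zero :: 'a

definition bl_le :: "('a, 'm) bl_scheme \<Rightarrow> 'a \<Rightarrow> 'a \<Rightarrow> bool" where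
  "bl_le A a b \<longleftrightarrow> bl_meet A a b = a"

definition bl_bounded_lattice :: "('a, 'm) bl_scheme \<Rightarrow> bool" where
  "bl_bounded_lattice A \<longleftrightarrow>
     bl_zero A \<in> carrier A \<and> one A \<in> carrier A \<and>
     (\<forall>a\<in>carrier A. \<forall>b\<in>carrier A. bl_meet A a b \<in> carrier A \<and> bl_join A a b \<in> carrier A) \<and>
     (\<forall>a\<in>carrier A. \<forall>b\<in>carrier A.
        bl_meet A a b = bl_meet A b a \<and> bl_join A a b = bl_join A b a \<and>
        bl_meet A a (bl_join A a b) = a \<and> bl_join A a (bl_meet A a b) = a) \<and>
     (\<forall>a\<in>carrier A. \<forall>b\<in>carrier A. \<forall>c\<in>carrier A.
        bl_meet A (bl_meet A a b) c = bl_meet A a (bl_meet A b c) \<and>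
        bl_join A (bl_join A a b) c = bl_join A a (bl_join A b c)) \<and>
     (\<forall>a\<in>carrier A. bl_le A (bl_zero A) a \<and> bl_le A a (one A))"

definition bl_algebra :: "('a, 'm) bl_scheme \<Rightarrow> bool" where
  "bl_algebra A \<longleftrightarrow>
     bl_bounded_lattice A \<and>
     comm_monoid A \<and>
     (\<forall>a\<in>carrier A. \<forall>b\<in>carrier A. bl_imp A a b \<in> carrier A) \<and>
     (\<forall>a\<in>carrier A. \<forall>b\<in>carrier A. \<forall>c\<in>carrier A.
        bl_le A (mult A a b) c \<longleftrightarrow> bl_le A a (bl_imp A b c)) \<and>
     (\<forall>a\<in>carrier A. \<forall>c\<in>carrier A. bl_join A (bl_imp A a c) (bl_imp A c a) = one A) \<and>
     (\<forall>a\<in>carrier A. \<forall>c\<in>carrier A. bl_meet A a c = mult A a (bl_imp A a c))"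

definition luk_mult :: "'a::linordered_field \<Rightarrow> 'a \<Rightarrow> 'a" where
  "luk_mult a c = max 0 (a + c - 1)"

definition luk_imp :: "'a::linordered_field \<Rightarrow> 'a \<Rightarrow> 'a" where
  "luk_imp a c = min 1 (1 - a + c)"

definition standard_mv :: "real bl" where
  "standard_mv = \<lparr> carrier = {0..1}, mult = luk_mult, one = 1,
     bl_meet = min, bl_join = max, bl_imp = luk_imp, bl_zero = 0 \<rparr>"

datatype bl_term =
    TVar nat
  | TMeet bl_term bl_term
  | TJoin bl_term bl_term
  | TMult bl_term bl_term
  | TImp bl_term bl_term
  | TZero
  | TOne

primrec bl_eval :: "('a, 'm) bl_scheme \<Rightarrow> (nat \<Rightarrow> 'a) \<Rightarrow> bl_term \<Rightarrow> 'a" where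
  "bl_eval A v (TVar i) = v i"
| "bl_eval A v (TMeet s t) = bl_meet A (bl_eval A v s) (bl_eval A v t)"
| "bl_eval A v (TJoin s t) = bl_join A (bl_eval A v s) (bl_eval A v t)"
| "bl_eval A v (TMult s t) = mult A (bl_eval A v s) (bl_eval A v t)"
| "bl_eval A v (TImp s t) = bl_imp A (bl_eval A v s) (bl_eval A v t)"
| "bl_eval A v TZero = bl_zero A"
| "bl_eval A v TOne = one A"

definition bl_identity :: "('a, 'm) bl_scheme \<Rightarrow> bl_term \<Rightarrow> bl_term \<Rightarrow> bool" where
  "bl_identity A s t \<longleftrightarrow> (\<forall>v. range v \<subseteq> carrier A \<longrightarrow> bl_eval A v s = bl_eval A v t)"

text \<open>The variety generated by the standard algebra is the least equational class containing it,
  i.e. the class of all algebras satisfying every identity of the standard algebra.\<close>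

definition mv_algebra :: "('a, 'm) bl_scheme \<Rightarrow> bool" where
  "mv_algebra A \<longleftrightarrow>
     bl_algebra A \<and> (\<forall>s t. bl_identity standard_mv s t \<longrightarrow> bl_identity A s t)"

section \<open>Rational MV-algebras\<close>

typedef unit_rat = "{q :: rat. 0 \<le> q \<and> q \<le> 1}"
  by (rule exI[of _ 0]) simp

setup_lifting type_definition_unit_rat

lift_definition ur_zero :: unit_rat is 0 by simp
lift_definition ur_one :: unit_rat is 1 by simp
lift_definition ur_mult :: "unit_rat \<Rightarrow> unit_rat \<Rightarrow> unit_rat" is luk_mult
  by (auto simp: luk_mult_def)
lift_definition ur_imp :: "unit_rat \<Rightarrow> unit_rat \<Rightarrow> unit_rat" is luk_imp
  by (auto simp: luk_imp_def)

record 'a rmv = "'a bl" +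
  rmv_const :: "unit_rat \<Rightarrow> 'a"

definition rmv_algebra :: "('a, 'm) rmv_scheme \<Rightarrow> bool" where
  "rmv_algebra A \<longleftrightarrow>
     mv_algebra A \<and>
     (\<forall>q. rmv_const A q \<in> carrier A) \<and>
     (\<forall>p q. mult A (rmv_const A p) (rmv_const A q) = rmv_const A (ur_mult p q)) \<and>
     (\<forall>p q. bl_imp A (rmv_const A p) (rmv_const A q) = rmv_const A (ur_imp p q)) \<and>
     rmv_const A ur_zero = bl_zero A \<and>
     rmv_const A ur_one = one A"

section \<open>Formulas and logics\<close>

datatype fm =
    Var nat
  | Const unit_rat
  | Meet fm fm
  | Join fm fm
  | Mult fm fm
  | Imp fm fm
  | Zero
  | One

primrec fm_eval :: "('a, 'm) rmv_scheme \<Rightarrow> (nat \<Rightarrow> 'a) \<Rightarrow> fm \<Rightarrow> 'a" where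
  "fm_eval A v (Var i) = v i"
| "fm_eval A v (Const q) = rmv_const A q"
| "fm_eval A v (Meet s t) = bl_meet A (fm_eval A v s) (fm_eval A v t)"
| "fm_eval A v (Join s t) = bl_join A (fm_eval A v s) (fm_eval A v t)"
| "fm_eval A v (Mult s t) = mult A (fm_eval A v s) (fm_eval A v t)"
| "fm_eval A v (Imp s t) = bl_imp A (fm_eval A v s) (fm_eval A v t)"
| "fm_eval A v Zero = bl_zero A"
| "fm_eval A v One = one A"

primrec fm_subst :: "(nat \<Rightarrow> fm) \<Rightarrow> fm \<Rightarrow> fm" where
  "fm_subst \<sigma> (Var i) = \<sigma> i"
| "fm_subst \<sigma> (Const q) = Const q"
| "fm_subst \<sigma> (Meet s t) = Meet (fm_subst \<sigma> s) (fm_subst \<sigma> t)"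
| "fm_subst \<sigma> (Join s t) = Join (fm_subst \<sigma> s) (fm_subst \<sigma> t)"
| "fm_subst \<sigma> (Mult s t) = Mult (fm_subst \<sigma> s) (fm_subst \<sigma> t)"
| "fm_subst \<sigma> (Imp s t) = Imp (fm_subst \<sigma> s) (fm_subst \<sigma> t)"
| "fm_subst \<sigma> Zero = Zero"
| "fm_subst \<sigma> One = One"

type_synonym conseq = "fm set \<Rightarrow> fm \<Rightarrow> bool"

definition is_logic :: "conseq \<Rightarrow> bool" where
  "is_logic L \<longleftrightarrow>
     (\<forall>\<Gamma> \<phi>. \<phi> \<in> \<Gamma> \<longrightarrow> L \<Gamma> \<phi>) \<and>
     (\<forall>\<Gamma> \<Delta> \<phi>. L \<Gamma> \<phi> \<longrightarrow> \<Gamma> \<subseteq> \<Delta> \<longrightarrow> L \<Delta> \<phi>) \<and>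
     (\<forall>\<Gamma> \<Delta> \<phi>. (\<forall>\<delta>\<in>\<Delta>. L \<Gamma> \<delta>) \<longrightarrow> L \<Delta> \<phi> \<longrightarrow> L \<Gamma> \<phi>) \<and>
     (\<forall>\<Gamma> \<phi>. L \<Gamma> \<phi> \<longrightarrow> (\<exists>\<Delta>. finite \<Delta> \<and> \<Delta> \<subseteq> \<Gamma> \<and> L \<Delta> \<phi>)) \<and>
     (\<forall>\<sigma> \<Gamma> \<phi>. L \<Gamma> \<phi> \<longrightarrow> L (fm_subst \<sigma> ` \<Gamma>) (fm_subst \<sigma> \<phi>))"

definition extension_of :: "conseq \<Rightarrow> conseq \<Rightarrow> bool" where
  "extension_of L' L \<longleftrightarrow> is_logic L' \<and> (\<forall>\<Gamma> \<phi>. L \<Gamma> \<phi> \<longrightarrow> L' \<Gamma> \<phi>)"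

definition consistent :: "conseq \<Rightarrow> bool" where
  "consistent L \<longleftrightarrow> \<not> (\<forall>\<phi>. L {} \<phi>)"

definition derivable :: "conseq \<Rightarrow> fm set \<Rightarrow> fm \<Rightarrow> bool" where
  "derivable L \<Gamma> \<phi> \<longleftrightarrow> L \<Gamma> \<phi>"

definition admissible :: "conseq \<Rightarrow> fm set \<Rightarrow> fm \<Rightarrow> bool" where
  "admissible L \<Gamma> \<phi> \<longleftrightarrow>
     (\<forall>\<sigma>. (\<forall>\<gamma>\<in>\<Gamma>. L {} (fm_subst \<sigma> \<gamma>)) \<longrightarrow> L {} (fm_subst \<sigma> \<phi>))"

definition structurally_complete :: "conseq \<Rightarrow> bool" where
  "structurally_complete L \<longleftrightarrow>
     (\<forall>\<Gamma> \<phi>. finite \<Gamma> \<longrightarrow> admissible L \<Gamma> \<phi> \<longrightarrow> derivable L \<Gamma> \<phi>)"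

definition hereditarily_structurally_complete :: "conseq \<Rightarrow> bool" where
  "hereditarily_structurally_complete L \<longleftrightarrow>
     (\<forall>L'. extension_of L' L \<longrightarrow> structurally_complete L')"

section \<open>Rational Lukasiewicz logic\<close>

definition rmv_valid :: "('a, 'm) rmv_scheme \<Rightarrow> fm set \<Rightarrow> fm \<Rightarrow> bool" where
  "rmv_valid A \<Delta> \<phi> \<longleftrightarrow>
     (\<forall>v. range v \<subseteq> carrier A \<longrightarrow> (\<forall>\<delta>\<in>\<Delta>. fm_eval A v \<delta> = one A) \<longrightarrow> fm_eval A v \<phi> = one A)"

text \<open>A definition cannot quantify over the types that carry algebras, so the algebras in the next
  definition have their elements in a fixed type.  The choice does not matter: by
  \<open>rmv_consequence_universe\<close> below, the relation so defined is the consequence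
  over all rational MV-algebras on all types.\<close>

definition rmv_consequence :: "fm set \<Rightarrow> fm \<Rightarrow> bool" where
  "rmv_consequence \<Delta> \<phi> \<longleftrightarrow> (\<forall>A :: real rmv. rmv_algebra A \<longrightarrow> rmv_valid A \<Delta> \<phi>)"

definition rational_luk :: conseq where
  "rational_luk \<Gamma> \<phi> \<longleftrightarrow> (\<exists>\<Delta>. finite \<Delta> \<and> \<Delta> \<subseteq> \<Gamma> \<and> rmv_consequence \<Delta> \<phi>)"

instance unit_rat :: countable
  by (rule countable_classI[of "to_nat \<circ> Rep_unit_rat"]) (simp add: Rep_unit_rat_inject)

instance fm :: countable
  by countable_datatype

lemma rmv_closed:
  assumes "rmv_algebra A"
  shows "one A \<in> carrier A" "bl_zero A \<in> carrier A" "rmv_const A q \<in> carrier A"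
    "\<lbrakk>a \<in> carrier A; b \<in> carrier A\<rbrakk> \<Longrightarrow> bl_meet A a b \<in> carrier A"
    "\<lbrakk>a \<in> carrier A; b \<in> carrier A\<rbrakk> \<Longrightarrow> bl_join A a b \<in> carrier A"
    "\<lbrakk>a \<in> carrier A; b \<in> carrier A\<rbrakk> \<Longrightarrow> mult A a b \<in> carrier A"
    "\<lbrakk>a \<in> carrier A; b \<in> carrier A\<rbrakk> \<Longrightarrow> bl_imp A a b \<in> carrier A"
proof -
  have bl: "bl_bounded_lattice A" "comm_monoid A"
    "\<forall>a\<in>carrier A. \<forall>b\<in>carrier A. bl_imp A a b \<in> carrier A"
    using assms unfolding rmv_algebra_def mv_algebra_def bl_algebra_def by blast+
  show "one A \<in> carrier A" "bl_zero A \<in> carrier A"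
    "\<lbrakk>a \<in> carrier A; b \<in> carrier A\<rbrakk> \<Longrightarrow> bl_meet A a b \<in> carrier A"
    "\<lbrakk>a \<in> carrier A; b \<in> carrier A\<rbrakk> \<Longrightarrow> bl_join A a b \<in> carrier A"
    using bl(1) unfolding bl_bounded_lattice_def by blast+
  show "rmv_const A q \<in> carrier A"
    using assms unfolding rmv_algebra_def by blast
  show "\<lbrakk>a \<in> carrier A; b \<in> carrier A\<rbrakk> \<Longrightarrow> mult A a b \<in> carrier A"
    using bl(2) by (simp add: comm_monoid_def monoid.m_closed)
  show "\<lbrakk>a \<in> carrier A; b \<in> carrier A\<rbrakk> \<Longrightarrow> bl_imp A a b \<in> carrier A"
    using bl(3) by blast
qed

lemma fm_eval_closed:
  assumes "rmv_algebra A" "range v \<subseteq> carrier A"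
  shows "fm_eval A v \<phi> \<in> carrier A"
  by (induction \<phi>) (use assms(2) in \<open>auto simp: rmv_closed[OF assms(1)]\<close>)

lemma fm_eval_subst: "fm_eval A v (fm_subst \<sigma> \<phi>) = fm_eval A (\<lambda>i. fm_eval A v (\<sigma> i)) \<phi>"
  by (induction \<phi>) auto

lemma rmv_consequence_universe:
  fixes A :: "('a, 'm) rmv_scheme"
  assumes cons: "rmv_consequence \<Delta> \<phi>" and A: "rmv_algebra A"
  shows "rmv_valid A \<Delta> \<phi>"
  unfolding rmv_valid_def
proof (intro allI impI)
  fix v assume v: "range v \<subseteq> carrier A" and \<Delta>: "\<forall>\<delta>\<in>\<Delta>. fm_eval A v \<delta> = one A"
  define S where "S = range (fm_eval A v)"
  define g where "g = (\<lambda>a. real (to_nat (SOME \<chi>. fm_eval A v \<chi> = a)))"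
  define h where "h = inv_into S g"
  have "fm_eval A v (SOME \<chi>. fm_eval A v \<chi> = a) = a" if "a \<in> S" for a
    using that unfolding S_def by (metis (mono_tags, lifting) imageE someI_ex)
  then have "inj_on g S"
    unfolding g_def inj_on_def by (metis of_nat_eq_iff to_nat_split)
  then have hg [simp]: "h (g a) = a" if "a \<in> S" for a
    using that by (simp add: h_def)
  have SA: "a \<in> carrier A" if "a \<in> S" for a
    using that fm_eval_closed[OF A v] by (auto simp: S_def)
  have S [simp]: "one A \<in> S" "bl_zero A \<in> S" "rmv_const A q \<in> S" for q
    unfolding S_def
    by (metis fm_eval.simps(8) rangeI, metis fm_eval.simps(7) rangeI, metis fm_eval.simps(2) rangeI)
  have S_op [simp]: "bl_meet A a b \<in> S" "bl_join A a b \<in> S" "mult A a b \<in> S" "bl_imp A a b \<in> S"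
    if ab: "a \<in> S" "b \<in> S" for a b
  proof -
    obtain s t where "a = fm_eval A v s" "b = fm_eval A v t"
      using ab by (auto simp: S_def)
    then show "bl_meet A a b \<in> S" "bl_join A a b \<in> S" "mult A a b \<in> S" "bl_imp A a b \<in> S"
      using rangeI[of "fm_eval A v" "Meet s t"] rangeI[of "fm_eval A v" "Join s t"]
        rangeI[of "fm_eval A v" "Mult s t"] rangeI[of "fm_eval A v" "Imp s t"]
      by (simp_all add: S_def)
  qed
  define B :: "real rmv" where
    "B = \<lparr> carrier = g ` S, mult = (\<lambda>x y. g (mult A (h x) (h y))), one = g (one A),
       bl_meet = (\<lambda>x y. g (bl_meet A (h x) (h y))), bl_join = (\<lambda>x y. g (bl_join A (h x) (h y))),
       bl_imp = (\<lambda>x y. g (bl_imp A (h x) (h y))), bl_zero = g (bl_zero A),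
       rmv_const = (\<lambda>q. g (rmv_const A q)) \<rparr>"
  have le: "bl_le B (g a) (g b) \<longleftrightarrow> bl_le A a b" if "a \<in> S" "b \<in> S" for a b
    using that \<open>inj_on g S\<close> by (auto simp: bl_le_def B_def inj_on_eq_iff)
  have bl: "bl_algebra A"
    using A by (simp add: rmv_algebra_def mv_algebra_def)
  have cB: "carrier B = g ` S" and
    oB: "one B = g (one A)" "bl_zero B = g (bl_zero A)" "\<And>q. rmv_const B q = g (rmv_const A q)"
    "\<And>a b. \<lbrakk>a \<in> S; b \<in> S\<rbrakk> \<Longrightarrow> bl_meet B (g a) (g b) = g (bl_meet A a b)"
    "\<And>a b. \<lbrakk>a \<in> S; b \<in> S\<rbrakk> \<Longrightarrow> bl_join B (g a) (g b) = g (bl_join A a b)"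
    "\<And>a b. \<lbrakk>a \<in> S; b \<in> S\<rbrakk> \<Longrightarrow> mult B (g a) (g b) = g (mult A a b)"
    "\<And>a b. \<lbrakk>a \<in> S; b \<in> S\<rbrakk> \<Longrightarrow> bl_imp B (g a) (g b) = g (bl_imp A a b)"
    by (simp_all add: B_def)
  have eqB: "g a = g b \<longleftrightarrow> a = b" if "a \<in> S" "b \<in> S" for a b
    using that \<open>inj_on g S\<close> by (simp add: inj_on_eq_iff)
  have L: "bl_bounded_lattice A" and M: "comm_monoid A"
    using bl unfolding bl_algebra_def by - (elim conjE; assumption)+
  have "\<forall>a\<in>carrier A. \<forall>b\<in>carrier A. \<forall>c\<in>carrier A.
      bl_le A (mult A a b) c \<longleftrightarrow> bl_le A a (bl_imp A b c)"
    and "\<forall>a\<in>carrier A. \<forall>c\<in>carrier A. bl_join A (bl_imp A a c) (bl_imp A c a) = one A"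
    and "\<forall>a\<in>carrier A. \<forall>c\<in>carrier A. bl_meet A a c = mult A a (bl_imp A a c)"
    using bl unfolding bl_algebra_def by - (elim conjE; assumption)+
  then have res: "bl_le A (mult A a b) c \<longleftrightarrow> bl_le A a (bl_imp A b c)"
    and prel: "bl_join A (bl_imp A a c) (bl_imp A c a) = one A"
    and dvs: "bl_meet A a c = mult A a (bl_imp A a c)" if "a \<in> S" "b \<in> S" "c \<in> S" for a b c
    using that SA by metis+
  have "\<forall>a\<in>carrier A. \<forall>b\<in>carrier A.
        bl_meet A a b = bl_meet A b a \<and> bl_join A a b = bl_join A b a \<and>
        bl_meet A a (bl_join A a b) = a \<and> bl_join A a (bl_meet A a b) = a"
    and "\<forall>a\<in>carrier A. \<forall>b\<in>carrier A. \<forall>c\<in>carrier A.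
        bl_meet A (bl_meet A a b) c = bl_meet A a (bl_meet A b c) \<and>
        bl_join A (bl_join A a b) c = bl_join A a (bl_join A b c)"
    and "\<forall>a\<in>carrier A. bl_le A (bl_zero A) a \<and> bl_le A a (one A)"
    using L unfolding bl_bounded_lattice_def by - (elim conjE; assumption)+
  then have lat1: "bl_meet A a b = bl_meet A b a \<and> bl_join A a b = bl_join A b a \<and>
        bl_meet A a (bl_join A a b) = a \<and> bl_join A a (bl_meet A a b) = a"
    and lat2: "bl_meet A (bl_meet A a b) c = bl_meet A a (bl_meet A b c) \<and>
        bl_join A (bl_join A a b) c = bl_join A a (bl_join A b c)"
    and lat3: "bl_le A (bl_zero A) a \<and> bl_le A a (one A)" if "a \<in> S" "b \<in> S" "c \<in> S" for a b c
    using that SA by metis+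
  have "bl_bounded_lattice B"
    unfolding bl_bounded_lattice_def
    apply (intro conjI)
    subgoal by (simp add: cB oB)
    subgoal by (simp add: cB oB)
    subgoal by (simp add: cB oB)
    subgoal by (simp add: cB oB eqB) (intro ballI lat1; assumption)
    subgoal by (simp add: cB oB eqB) (intro ballI lat2; assumption)
    subgoal by (simp add: cB oB le) (intro ballI lat3; assumption)
    done
  moreover have "comm_monoid B"
  proof -
    have "Group.monoid A"
      using M by (simp add: comm_monoid_def)
    then have "Group.monoid B"
      by unfold_locales (auto simp: cB oB SA monoid.m_assoc monoid.l_one monoid.r_one)
    then show ?thesis
      by (rule monoid.monoid_comm_monoidI)
        (auto simp: cB oB intro!: arg_cong[of _ _ g] comm_monoid.m_comm[OF M] SA)
  qed
  moreover have "\<forall>a\<in>carrier B. \<forall>b\<in>carrier B. bl_imp B a b \<in> carrier B"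
    by (simp add: cB oB)
  moreover have "\<forall>a\<in>carrier B. \<forall>b\<in>carrier B. \<forall>c\<in>carrier B.
      bl_le B (mult B a b) c \<longleftrightarrow> bl_le B a (bl_imp B b c)"
    by (simp add: cB oB le) (intro ballI res; assumption)
  moreover have "\<forall>a\<in>carrier B. \<forall>c\<in>carrier B. bl_join B (bl_imp B a c) (bl_imp B c a) = one B"
    by (simp add: cB oB eqB) (intro ballI prel; assumption)
  moreover have "\<forall>a\<in>carrier B. \<forall>c\<in>carrier B. bl_meet B a c = mult B a (bl_imp B a c)"
    by (simp add: cB oB eqB) (intro ballI dvs; assumption)
  ultimately have "bl_algebra B"
    unfolding bl_algebra_def by blast
  moreover have "bl_identity B s t" if "bl_identity A s t" for s t
    unfolding bl_identity_def
  proof (intro allI impI)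
    fix w :: "nat \<Rightarrow> real" assume w: "range w \<subseteq> carrier B"
    then have hw: "h (w i) \<in> S" "g (h (w i)) = w i" for i
    proof -
      obtain a where "a \<in> S" "w i = g a"
        using w cB by auto
      then show "h (w i) \<in> S" "g (h (w i)) = w i"
        by simp_all
    qed
    have ev: "bl_eval A (\<lambda>i. h (w i)) r \<in> S \<and> bl_eval B w r = g (bl_eval A (\<lambda>i. h (w i)) r)" for r
      by (induction r) (auto simp: hw B_def)
    have "range (\<lambda>i. h (w i)) \<subseteq> carrier A"
      using hw SA by auto
    then have "bl_eval A (\<lambda>i. h (w i)) s = bl_eval A (\<lambda>i. h (w i)) t"
      using that unfolding bl_identity_def by blast
    then show "bl_eval B w s = bl_eval B w t"
      using ev[of s] ev[of t] by simp
  qed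
  ultimately have "mv_algebra B"
    using A by (simp add: rmv_algebra_def mv_algebra_def)
  then have "rmv_algebra B"
    using A S unfolding rmv_algebra_def by (simp add: cB oB)
  then have valid: "rmv_valid B \<Delta> \<phi>"
    using cons by (simp add: rmv_consequence_def)
  have vS: "v i \<in> S" for i
    unfolding S_def by (metis fm_eval.simps(1) rangeI)
  have ev: "fm_eval B (\<lambda>i. g (v i)) \<chi> = g (fm_eval A v \<chi>) \<and> fm_eval A v \<chi> \<in> S" for \<chi>
    by (induction \<chi>) (auto simp: B_def vS)
  have rng: "range (\<lambda>i. g (v i)) \<subseteq> carrier B"
    using vS by (auto simp: B_def)
  have prem: "\<forall>\<delta>\<in>\<Delta>. fm_eval B (\<lambda>i. g (v i)) \<delta> = one B"
    using \<Delta> ev oB(1) by simp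
  have "fm_eval B (\<lambda>i. g (v i)) \<phi> = one B"
    using valid[unfolded rmv_valid_def, rule_format, OF rng] prem by blast
  then have "g (fm_eval A v \<phi>) = g (one A)"
    using ev oB(1) by auto
  then show "fm_eval A v \<phi> = one A"
    using ev S(1) \<open>inj_on g S\<close> by (metis inj_onD)
qed

lemma is_logic_rational_luk: "is_logic rational_luk"
  unfolding is_logic_def
proof (intro conjI allI impI)
  fix \<Gamma> :: "fm set" and \<phi> assume "\<phi> \<in> \<Gamma>"
  then show "rational_luk \<Gamma> \<phi>"
    unfolding rational_luk_def rmv_consequence_def rmv_valid_def by (intro exI[of _ "{\<phi>}"]) auto
next
  fix \<Gamma> \<Delta> \<phi> assume "rational_luk \<Gamma> \<phi>" "\<Gamma> \<subseteq> \<Delta>"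
  then show "rational_luk \<Delta> \<phi>"
    unfolding rational_luk_def by (meson subset_trans)
next
  fix \<Gamma> \<Delta> \<phi> assume \<Gamma>: "\<forall>\<delta>\<in>\<Delta>. rational_luk \<Gamma> \<delta>" and "rational_luk \<Delta> \<phi>"
  then obtain D where D: "finite D" "D \<subseteq> \<Delta>" "rmv_consequence D \<phi>"
    by (auto simp: rational_luk_def)
  have "\<forall>\<delta>\<in>D. \<exists>E. finite E \<and> E \<subseteq> \<Gamma> \<and> rmv_consequence E \<delta>"
    using \<Gamma> D(2) by (auto simp: rational_luk_def)
  then obtain E where E: "\<forall>\<delta>\<in>D. finite (E \<delta>) \<and> E \<delta> \<subseteq> \<Gamma> \<and> rmv_consequence (E \<delta>) \<delta>"
    by metis
  then have "rmv_consequence (\<Union>(E ` D)) \<phi>"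
    using D(3) by (fastforce simp: rmv_consequence_def rmv_valid_def)
  then show "rational_luk \<Gamma> \<phi>"
    unfolding rational_luk_def using D(1) E by (intro exI[of _ "\<Union>(E ` D)"]) auto
next
  fix \<Gamma> \<phi> assume "rational_luk \<Gamma> \<phi>"
  then show "\<exists>\<Delta>. finite \<Delta> \<and> \<Delta> \<subseteq> \<Gamma> \<and> rational_luk \<Delta> \<phi>"
    unfolding rational_luk_def by blast
next
  fix \<sigma> \<Gamma> \<phi> assume "rational_luk \<Gamma> \<phi>"
  then obtain D where D: "finite D" "D \<subseteq> \<Gamma>" "rmv_consequence D \<phi>"
    by (auto simp: rational_luk_def)
  have "rmv_consequence (fm_subst \<sigma> ` D) (fm_subst \<sigma> \<phi>)"
    unfolding rmv_consequence_def rmv_valid_def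
  proof (intro allI impI)
    fix A :: "real rmv" and v
    assume A: "rmv_algebra A" and v: "range v \<subseteq> carrier A"
      and 1: "\<forall>\<delta>\<in>fm_subst \<sigma> ` D. fm_eval A v \<delta> = one A"
    have "range (\<lambda>i. fm_eval A v (\<sigma> i)) \<subseteq> carrier A"
      using fm_eval_closed[OF A v] by auto
    then show "fm_eval A v (fm_subst \<sigma> \<phi>) = one A"
      using D(3) A 1 by (auto simp: rmv_consequence_def rmv_valid_def fm_eval_subst)
  qed
  then show "rational_luk (fm_subst \<sigma> ` \<Gamma>) (fm_subst \<sigma> \<phi>)"
    unfolding rational_luk_def using D by (intro exI[of _ "fm_subst \<sigma> ` D"]) auto
qed

lemma bl_algebra_standard_mv: "bl_algebra standard_mv"
proof -
  have "comm_monoid standard_mv"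
    by unfold_locales (auto simp: standard_mv_def luk_mult_def max_def)
  then show ?thesis
    unfolding bl_algebra_def bl_bounded_lattice_def
    by (auto simp: standard_mv_def bl_le_def luk_mult_def luk_imp_def min_def max_def)
qed

lemma consistent_rational_luk: "consistent rational_luk"
proof -
  have of_rat_max: "(of_rat (max p q) :: real) = max (of_rat p) (of_rat q)"
    and of_rat_min: "(of_rat (min p q) :: real) = min (of_rat p) (of_rat q)" for p q
    by (simp_all add: max_def min_def of_rat_less_eq)
  define R :: "real rmv" where
    "R = bl.extend standard_mv \<lparr> rmv_const = (\<lambda>q. of_rat (Rep_unit_rat q)) \<rparr>"
  note R = R_def bl.extend_def standard_mv_def
  have Rep: "0 \<le> Rep_unit_rat q" "Rep_unit_rat q \<le> 1" for q
    using Rep_unit_rat[of q] by auto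
  have "comm_monoid R"
    by unfold_locales (auto simp: R luk_mult_def max_def)
  moreover have eqs: "carrier R = carrier standard_mv" "mult R = mult standard_mv"
      "one R = one standard_mv" "bl_meet R = bl_meet standard_mv" "bl_join R = bl_join standard_mv"
      "bl_imp R = bl_imp standard_mv" "bl_zero R = bl_zero standard_mv"
    by (simp_all add: R)
  ultimately have bl: "bl_algebra R"
    using bl_algebra_standard_mv
    unfolding bl_algebra_def bl_bounded_lattice_def bl_le_def eqs
    by - (elim conjE, intro conjI; assumption)
  have "bl_eval R v t = bl_eval standard_mv v t" for v t
    by (induction t) (simp_all add: eqs)
  then have "mv_algebra R"
    using bl by (simp add: mv_algebra_def bl_identity_def eqs)
  moreover have "luk_mult (of_rat p) (of_rat q) = (of_rat (luk_mult p q) :: real)"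
      "luk_imp (of_rat p) (of_rat q) = (of_rat (luk_imp p q) :: real)" for p q
    by (simp_all add: luk_mult_def luk_imp_def of_rat_max of_rat_min of_rat_add of_rat_diff)
  ultimately have "rmv_algebra R"
    using Rep unfolding rmv_algebra_def
    by (simp add: R ur_mult.rep_eq ur_imp.rep_eq ur_zero.rep_eq ur_one.rep_eq)
  moreover have "\<not> rmv_valid R {} Zero"
    by (auto simp: rmv_valid_def R intro!: exI[of _ "\<lambda>_. 0"])
  ultimately show ?thesis
    by (auto simp: consistent_def rational_luk_def rmv_consequence_def)
qed

end

theory Submission
  imports Defs
begin

text \<open>If \<open>\<Gamma> \<turnstile> \<phi>\<close> fails for a finite \<open>\<Gamma>\<close>, then some valuation in the rational unit interval
  satisfies \<open>\<Gamma>\<close> but not \<open>\<phi>\<close>. Replacing the variables by the constants of this valuation turns \<open>\<Gamma>\<close>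
  into theorems and \<open>\<phi>\<close> into a constant \<open>c\<^sub>r\<close> with \<open>r < 1\<close>, whose powers reach \<open>c\<^sub>0\<close>. Hence a logic
  that adds the rule \<open>\<Gamma> \<rhd> \<phi>\<close> is inconsistent, and a rule that is not derivable is not admissible.

  For the existence of the valuation, suppose that \<open>s = 1\<close> entails \<open>t = 1\<close> at all rational points. As
  \<open>1 - s\<close> and \<open>1 - t\<close> are piecewise affine, Fourier-Motzkin elimination on each piece gives \<open>n\<close> with
  \<open>1 - t \<le> n (1 - s)\<close>. By density of the rationals this is an identity of the standard MV-algebra, so
  it holds in every MV-algebra, where it makes \<open>s = 1\<close> entail \<open>t = 1\<close>.\<close>

section \<open>Fourier-Motzkin elimination and piecewise affine functions\<close>

text \<open>Points are functions on all of \<open>nat\<close> for every \<open>k\<close>, so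
  eliminating a coordinate lowers \<open>k\<close> without changing the type of the points.\<close>

definition affine_form :: "nat \<Rightarrow> ((nat \<Rightarrow> 'a::linordered_field) \<Rightarrow> 'a) \<Rightarrow> bool" where
  "affine_form k F \<longleftrightarrow> (\<exists>c a. \<forall>x. F x = c + (\<Sum>i<k. a i * x i))"

lemma affine_form_const: "affine_form k (\<lambda>x. c)"
  unfolding affine_form_def by (intro exI[of _ c] exI[of _ "\<lambda>_. 0"]) simp

lemma affine_form_var: "i < k \<Longrightarrow> affine_form k (\<lambda>x. x i)"
  unfolding affine_form_def
  by (intro exI[of _ 0] exI[of _ "\<lambda>j. if j = i then 1 else 0"]) (simp add: if_distrib[of "\<lambda>a. a * _"] cong: if_cong)

lemma affine_form_add:
  assumes "affine_form k F" "affine_form k G"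
  shows "affine_form k (\<lambda>x. F x + G x)"
proof -
  obtain c a d b where "\<And>x. F x = c + (\<Sum>i<k. a i * x i)" "\<And>x. G x = d + (\<Sum>i<k. b i * x i)"
    using assms unfolding affine_form_def by auto
  then show ?thesis
    unfolding affine_form_def
    by (intro exI[of _ "c + d"] exI[of _ "\<lambda>i. a i + b i"]) (simp add: distrib_right sum.distrib)
qed

lemma affine_form_scale:
  assumes "affine_form k F"
  shows "affine_form k (\<lambda>x. r * F x)"
proof -
  obtain c a where "\<And>x. F x = c + (\<Sum>i<k. a i * x i)"
    using assms unfolding affine_form_def by auto
  then show ?thesis
    unfolding affine_form_def
    by (intro exI[of _ "r * c"] exI[of _ "\<lambda>i. r * a i"]) (simp add: distrib_left sum_distrib_left mult.assoc)
qed

lemma affine_form_uminus: "affine_form k F \<Longrightarrow> affine_form k (\<lambda>x. - F x)"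
  using affine_form_scale[of k F "- 1"] by simp

lemma affine_form_diff:
  assumes "affine_form k F" "affine_form k G"
  shows "affine_form k (\<lambda>x. F x - G x)"
  using affine_form_add[OF assms(1) affine_form_uminus[OF assms(2)]] by simp

lemma affine_form_Suc:
  assumes "affine_form (Suc k) F"
  obtains a G where "affine_form k G" "F = (\<lambda>x. a * x k + G x)"
proof -
  obtain c a where "\<And>x. F x = c + (\<Sum>i<Suc k. a i * x i)"
    using assms unfolding affine_form_def by auto
  then show ?thesis
    by (intro that[of "\<lambda>x. c + (\<Sum>i<k. a i * x i)" "a k"]) (auto simp: affine_form_def)
qed

lemma affine_form_cong:
  assumes "affine_form k F" "\<And>i. i < k \<Longrightarrow> x i = y i"
  shows "F x = F y"
  using assms unfolding affine_form_def by (auto intro!: sum.cong)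

section \<open>Systems of strict and weak inequalities\<close>

text \<open>The flag marks a strict inequality.\<close>

abbreviation pos_if :: "bool \<Rightarrow> 'a::linordered_field \<Rightarrow> bool" where
  "pos_if b r \<equiv> (if b then 0 < r else 0 \<le> r)"

lemma pos_if_scale: "0 < r \<Longrightarrow> pos_if b (r * s) \<longleftrightarrow> pos_if b s"
  by (simp add: zero_less_mult_iff zero_le_mult_iff)


text \<open>These are the consequences of the system \<open>P\<close> by positive combination. A sum
  is strict as soon as one summand is, and a constant of the wrong sign certifies that
  \<open>P\<close> has no solution.\<close>

inductive cone :: "(('b \<Rightarrow> 'a::linordered_field) \<times> bool) set \<Rightarrow> ('b \<Rightarrow> 'a) \<Rightarrow> bool \<Rightarrow> bool"
  for P where
  cone_base: "(F, b) \<in> P \<Longrightarrow> cone P F b"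
| cone_add: "cone P F b \<Longrightarrow> cone P G c \<Longrightarrow> cone P (\<lambda>x. F x + G x) (b \<or> c)"
| cone_scale: "cone P F b \<Longrightarrow> 0 < r \<Longrightarrow> cone P (\<lambda>x. r * F x) b"

lemma cone_trans:
  assumes "cone Q F b" "\<And>F b. (F, b) \<in> Q \<Longrightarrow> cone P F b"
  shows "cone P F b"
  using assms(1) by induction (auto intro: assms(2) cone.intros)

text \<open>The elimination of one variable. If the largest lower bound is below the smallest upper
  bound, density gives a point strictly between them. If they coincide, pairwise compatibility
  excludes a strict bound at that point.\<close>

lemma between_bounds:
  fixes B :: "'i \<Rightarrow> 'a::linordered_field"
  assumes fin: "finite L" "finite U"
    and LU: "\<And>p q. p \<in> L \<Longrightarrow> q \<in> U \<Longrightarrow> pos_if (s p \<or> s q) (B q - B p)"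
  shows "\<exists>z. (\<forall>p\<in>L. pos_if (s p) (z - B p)) \<and> (\<forall>q\<in>U. pos_if (s q) (B q - z))"
proof (cases "L = {} \<or> U = {}")
  case True
  then show ?thesis
  proof
    assume "L = {}"
    moreover have "pos_if (s q) (B q - (Min (B ` U) - 1))" if "q \<in> U" for q
      using Min_le[OF finite_imageI[OF fin(2)] imageI[OF that, of B]] by auto
    ultimately show ?thesis by blast
  next
    assume "U = {}"
    moreover have "pos_if (s q) ((Max (B ` L) + 1) - B q)" if "q \<in> L" for q
      using Max_ge[OF finite_imageI[OF fin(1)] imageI[OF that, of B]] by auto
    ultimately show ?thesis by blast
  qed
next
  case False
  define l where "l = Max (B ` L)"
  define u where "u = Min (B ` U)"
  have l: "B p \<le> l" if "p \<in> L" for p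
    unfolding l_def using that fin by simp
  have u: "u \<le> B q" if "q \<in> U" for q
    unfolding u_def using that fin by simp
  obtain p0 where p0: "p0 \<in> L" "l = B p0"
    using Max_in[OF finite_imageI[OF fin(1), of B]] False unfolding l_def by blast
  obtain q0 where q0: "q0 \<in> U" "u = B q0"
    using Min_in[OF finite_imageI[OF fin(2), of B]] False unfolding u_def by blast
  have "l \<le> u"
    using LU[OF p0(1) q0(1)] p0 q0 by (auto split: if_splits)
  show ?thesis
  proof (cases "l = u")
    case True
    have "pos_if (s p) (l - B p)" if "p \<in> L" for p
      using LU[OF that q0(1)] q0 l[OF that] True by (auto split: if_splits)
    moreover have "pos_if (s q) (B q - l)" if "q \<in> U" for q
      using LU[OF p0(1) that] p0 u[OF that] True by (auto split: if_splits)
    ultimately show ?thesis by blast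
  next
    case False
    then obtain z where "l < z" "z < u"
      using \<open>l \<le> u\<close> dense by (metis order_le_less)
    then have "pos_if (s p) (z - B p)" if "p \<in> L" for p
      using l[OF that] by auto
    moreover have "pos_if (s q) (B q - z)" if "q \<in> U" for q
      using u[OF that] \<open>z < u\<close> by auto
    ultimately show ?thesis by blast
  qed
qed

text \<open>With no coordinate left, a violated inequality is itself a constant. Otherwise forms
  with positive and negative coefficient at the last coordinate are paired so that it cancels. A
  solution of the smaller system would extend to one of \<open>P\<close> by
  \<open>between_bounds\<close>, so induction gives a certificate, which is again a combination of
  members of \<open>P\<close>.\<close>

theorem fourier_motzkin:
  fixes P :: "(((nat \<Rightarrow> 'a::linordered_field) \<Rightarrow> 'a) \<times> bool) set"
  assumes "finite P" "\<And>F b. (F, b) \<in> P \<Longrightarrow> affine_form k F"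
    and "\<And>x. \<exists>(F, b)\<in>P. \<not> pos_if b (F x)"
  shows "\<exists>c b. cone P (\<lambda>x. c) b \<and> \<not> pos_if b c"
  using assms
proof (induction k arbitrary: P)
  case 0
  obtain F b where Fb: "(F, b) \<in> P" "\<not> pos_if b (F (\<lambda>_. 0))"
    using "0.prems"(3)[of "\<lambda>_. 0"] by auto
  have "F = (\<lambda>x. F (\<lambda>_. 0))"
    using affine_form_cong[OF "0.prems"(2)[OF Fb(1)]] by blast
  then have "cone P (\<lambda>x. F (\<lambda>_. 0)) b"
    using cone_base[OF Fb(1)] by simp
  then show ?case
    using Fb(2) by blast
next
  case (Suc k)
  have "\<forall>p\<in>P. \<exists>a G. affine_form k G \<and> fst p = (\<lambda>x. a * x k + G x)"
    using Suc.prems(2) affine_form_Suc by (metis prod.collapse)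
  then obtain A G where AG: "\<And>p. p \<in> P \<Longrightarrow> affine_form k (G p)"
      "\<And>p. p \<in> P \<Longrightarrow> fst p = (\<lambda>x. A p * x k + G p x)"
    by metis
  define L where "L = {p \<in> P. 0 < A p}"
  define U where "U = {p \<in> P. A p < 0}"
  \<comment> \<open>Both factors \<open>- A q\<close> and \<open>A p\<close> are positive on
    \<open>L \<times> U\<close>, and the terms in \<open>x k\<close> cancel.\<close>
  define comb where "comb = (\<lambda>(p, q).
    ((\<lambda>x. - A q * fst p x + A p * fst q x), snd p \<or> snd q))"
  define Q where "Q = {p \<in> P. A p = 0} \<union> comb ` (L \<times> U)"
  have fin: "finite L" "finite U" "finite Q"
    using Suc.prems(1) by (auto simp: L_def U_def Q_def)
  have Q_affine: "affine_form k F" if Fb: "(F, b) \<in> Q" for F b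
  proof -
    consider "(F, b) \<in> P" "A (F, b) = 0" | p q where "p \<in> L" "q \<in> U" "(F, b) = comb (p, q)"
      using Fb by (auto simp: Q_def)
    then show ?thesis
    proof cases
      case 1
      then show ?thesis using AG[OF 1(1)] by simp
    next
      case 2
      then have pq: "p \<in> P" "q \<in> P" by (auto simp: L_def U_def)
      have "F = (\<lambda>x. - A q * G p x + A p * G q x)"
        using 2(3) AG(2)[OF pq(1)] AG(2)[OF pq(2)] by (auto simp: comb_def algebra_simps)
      then show ?thesis
        by (simp only:) (intro affine_form_add affine_form_scale AG(1) pq)
    qed
  qed
  have Q_cone: "cone P F b" if Fb: "(F, b) \<in> Q" for F b
  proof -
    consider "(F, b) \<in> P" | p q where "p \<in> L" "q \<in> U" "(F, b) = comb (p, q)"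
      using Fb by (auto simp: Q_def)
    then show ?thesis
    proof cases
      case 1
      then show ?thesis by (rule cone_base)
    next
      case 2
      then have "cone P (fst p) (snd p)" "cone P (fst q) (snd q)" "0 < - A q" "0 < A p"
        by (auto simp: L_def U_def intro: cone_base)
      then show ?thesis
        using 2(3) unfolding comb_def by (simp only: prod.case prod.inject) (intro cone_add cone_scale)
    qed
  qed
  have "\<exists>(F, b)\<in>Q. \<not> pos_if b (F x)" for x
  proof (rule ccontr)
    assume "\<not> ?thesis"
    then have sat: "pos_if b (F x)" if "(F, b) \<in> Q" for F b
      using that by blast
    \<comment> \<open>\<open>B p\<close> is the value of coordinate \<open>k\<close> at which the
      form of \<open>p\<close> vanishes: a lower bound for \<open>p\<close> in \<open>L\<close>, an
      upper bound for \<open>p\<close> in \<open>U\<close>.\<close>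
    define B where "B = (\<lambda>p. - G p x / A p)"
    have "pos_if (snd p \<or> snd q) (B q - B p)" if "p \<in> L" "q \<in> U" for p q
    proof -
      have pq: "p \<in> P" "q \<in> P" "0 < A p" "A q < 0"
        using that by (auto simp: L_def U_def)
      have "comb (p, q) \<in> Q"
        using that by (auto simp: Q_def)
      then have "pos_if (snd p \<or> snd q) (- A q * fst p x + A p * fst q x)"
        unfolding comb_def prod.case by (rule sat)
      moreover have "- A q * fst p x + A p * fst q x = (A p * - A q) * (B q - B p)"
        using pq AG(2)[OF pq(1)] AG(2)[OF pq(2)] by (simp add: B_def field_simps)
      moreover have "0 < A p * - A q"
        using pq by (simp add: mult_pos_neg)
      ultimately show ?thesis
        using pos_if_scale by metis
    qed
    then obtain z where z: "\<forall>p\<in>L. pos_if (snd p) (z - B p)" "\<forall>q\<in>U. pos_if (snd q) (B q - z)"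
      using between_bounds[OF fin(1,2), of snd B] by blast
    have "pos_if b (F (x(k := z)))" if Fb: "(F, b) \<in> P" for F b
    proof -
      let ?p = "(F, b)"
      have "G ?p (x(k := z)) = G ?p x"
        by (rule affine_form_cong[OF AG(1)[OF Fb]]) simp
      moreover have FE: "F y = A ?p * y k + G ?p y" for y
        using fun_cong[OF AG(2)[OF Fb], of y] by simp
      ultimately have F: "F (x(k := z)) = A ?p * z + G ?p x"
        by simp
      consider "A ?p = 0" | "0 < A ?p" | "A ?p < 0"
        by linarith
      then show ?thesis
      proof cases
        case 1
        then have "pos_if b (F x)"
          using Fb by (intro sat) (simp add: Q_def)
        moreover have "F (x(k := z)) = F x"
          using F FE[of x] 1 by simp
        ultimately show ?thesis
          by simp
      next
        case 2
        then have "pos_if b (A ?p * (z - B ?p))"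
          using bspec[OF z(1), of ?p] Fb pos_if_scale[OF 2, of b] by (simp add: L_def)
        moreover have "A ?p * (z - B ?p) = F (x(k := z))"
          using 2 F by (simp add: B_def field_simps)
        ultimately show ?thesis by (simp only:)
      next
        case 3
        then have "pos_if b (- A ?p * (B ?p - z))"
          using bspec[OF z(2), of ?p] Fb pos_if_scale[of "- A ?p" b "B ?p - z"] by (simp add: U_def)
        moreover have "- A ?p * (B ?p - z) = F (x(k := z))"
          using 3 F by (simp add: B_def field_simps)
        ultimately show ?thesis by (simp only:)
      qed
    qed
    then show False
      using Suc.prems(3)[of "x(k := z)"] by blast
  qed
  then obtain c b where "cone Q (\<lambda>x. c) b" "\<not> pos_if b c"
    using Suc.IH[OF fin(3)] Q_affine by blast
  then show ?case
    using cone_trans[OF _ Q_cone] by blast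
qed

text \<open>On the polyhedron given by \<open>P\<close>, the inequalities \<open>F \<le> 0\<close>
  and \<open>G > 0\<close> have no common solution. The certificate yields
  \<open>\<nu> * G - \<mu> * F \<le> c\<close> with \<open>c \<le> 0\<close>, to be divided by
  \<open>\<nu>\<close>. When \<open>\<nu> = 0\<close>, it keeps \<open>F\<close> away from zero, and
  \<open>G \<le> 1\<close> suffices.\<close>

lemma affine_zero_set_bound:
  assumes P: "finite P" "\<And>p. p \<in> P \<Longrightarrow> affine_form k p"
    and FG: "affine_form k F" "affine_form k G"
    and sat: "\<And>x. (\<forall>p\<in>P. 0 \<le> p x) \<Longrightarrow> 0 \<le> F x \<and> G x \<le> 1 \<and> (F x = 0 \<longrightarrow> G x \<le> 0)"
  shows "\<exists>n. 0 \<le> n \<and> (\<forall>x. (\<forall>p\<in>P. 0 \<le> p x) \<longrightarrow> G x \<le> n * F x)"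
proof -
  define Q where "Q = (\<lambda>p. (p, False)) ` P \<union> {(\<lambda>x. - F x, False), (G, True)}"
  have "finite Q"
    using P(1) by (simp add: Q_def)
  moreover have "affine_form k H" if "(H, b) \<in> Q" for H b
    using that P(2) FG affine_form_uminus[OF FG(1)] by (auto simp: Q_def)
  moreover have "\<exists>(H, b)\<in>Q. \<not> pos_if b (H x)" for x
  proof (rule ccontr)
    assume "\<not> ?thesis"
    then have "pos_if b (H x)" if "(H, b) \<in> Q" for H b
      using that by blast
    from this[of _ False] this[of "\<lambda>x. - F x" False] this[of G True]
    have "\<forall>p\<in>P. 0 \<le> p x" "0 \<le> - F x" "0 < G x"
      by (force simp: Q_def)+
    then show False
      using sat[of x] by auto
  qed
  ultimately obtain c b where c: "cone Q (\<lambda>x. c) b" "\<not> pos_if b c"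
    using fourier_motzkin[of Q k] by blast
  \<comment> \<open>\<open>\<mu>\<close> and \<open>\<nu>\<close> are the weights of
    \<open>- F\<close> and \<open>G\<close> in the combination; the other summands are nonnegative
    on the polyhedron. Strictness can only come from \<open>G\<close>.\<close>
  have "\<exists>\<mu> \<nu>. 0 \<le> \<mu> \<and> 0 \<le> \<nu> \<and> (b \<longrightarrow> 0 < \<nu>) \<and>
      (\<forall>x. (\<forall>p\<in>P. 0 \<le> p x) \<longrightarrow> \<nu> * G x - \<mu> * F x \<le> H x)" if "cone Q H b" for H b
    using that
  proof induction
    case (cone_base H b)
    then consider "H \<in> P" "\<not> b" | "H = (\<lambda>x. - F x)" "\<not> b" | "H = G" "b"
      by (auto simp: Q_def)
    then show ?case
    proof cases
      case 1
      then show ?thesis by (intro exI[of _ 0]) auto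
    next
      case 2
      then show ?thesis by (intro exI[of _ 1] exI[of _ 0]) auto
    next
      case 3
      then show ?thesis by (intro exI[of _ 0] exI[of _ 1]) auto
    qed
  next
    case (cone_add H b K d)
    then obtain \<mu> \<nu> \<mu>' \<nu>' where *: "0 \<le> \<mu>" "0 \<le> \<nu>" "b \<longrightarrow> 0 < \<nu>" "0 \<le> \<mu>'" "0 \<le> \<nu>'" "d \<longrightarrow> 0 < \<nu>'"
      "\<And>x. \<forall>p\<in>P. 0 \<le> p x \<Longrightarrow> \<nu> * G x - \<mu> * F x \<le> H x"
      "\<And>x. \<forall>p\<in>P. 0 \<le> p x \<Longrightarrow> \<nu>' * G x - \<mu>' * F x \<le> K x"
      by blast
    have "(\<nu> + \<nu>') * G x - (\<mu> + \<mu>') * F x \<le> H x + K x" if "\<forall>p\<in>P. 0 \<le> p x" for x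
      using add_mono[OF *(7)[OF that] *(8)[OF that]] by (simp add: algebra_simps)
    then show ?case
      using *(1-6) by (intro exI[of _ "\<mu> + \<mu>'"] exI[of _ "\<nu> + \<nu>'"]) auto
  next
    case (cone_scale H b r)
    then obtain \<mu> \<nu> where *: "0 \<le> \<mu>" "0 \<le> \<nu>" "b \<longrightarrow> 0 < \<nu>"
      "\<And>x. \<forall>p\<in>P. 0 \<le> p x \<Longrightarrow> \<nu> * G x - \<mu> * F x \<le> H x"
      by blast
    have "(r * \<nu>) * G x - (r * \<mu>) * F x \<le> r * H x" if "\<forall>p\<in>P. 0 \<le> p x" for x
      using mult_left_mono[OF *(4)[OF that], of r] cone_scale.hyps(2) by (simp add: algebra_simps)
    then show ?case
      using *(1-3) cone_scale.hyps(2) by (intro exI[of _ "r * \<mu>"] exI[of _ "r * \<nu>"]) auto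
  qed
  from this[OF c(1)] obtain \<mu> \<nu> where m: "0 \<le> \<mu>" "0 \<le> \<nu>" "b \<longrightarrow> 0 < \<nu>"
    "\<And>x. \<forall>p\<in>P. 0 \<le> p x \<Longrightarrow> \<nu> * G x - \<mu> * F x \<le> c"
    by blast
  show ?thesis
  proof (cases "0 < \<nu>")
    case True
    have "G x \<le> (\<mu> / \<nu>) * F x" if "\<forall>p\<in>P. 0 \<le> p x" for x
    proof -
      have "\<nu> * G x \<le> \<mu> * F x"
        using m(4)[OF that] c(2) by (auto split: if_splits)
      then show ?thesis
        using True by (simp add: field_simps)
    qed
    then show ?thesis
      using m(1) True by (intro exI[of _ "\<mu> / \<nu>"]) auto
  next
    case False
    then have "\<nu> = 0" "c < 0"
      using m c(2) by auto
    have "G x \<le> (\<mu> / - c) * F x" if "\<forall>p\<in>P. 0 \<le> p x" for x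
    proof -
      have "- c \<le> \<mu> * F x"
        using m(4)[OF that] \<open>\<nu> = 0\<close> by simp
      then have "1 \<le> (\<mu> / - c) * F x"
        using \<open>c < 0\<close> by (simp add: field_simps)
      then show ?thesis
        using sat[OF that] by linarith
    qed
    then show ?thesis
      using m(1) \<open>c < 0\<close> by (intro exI[of _ "\<mu> / - c"]) (auto simp: divide_nonneg_neg)
  qed
qed

section \<open>Piecewise affine functions\<close>

text \<open>Both pieces of a branch are closed, since a linear bound obtained on an open piece may blow up
  at its boundary.\<close>

inductive piecewise_affine :: "nat \<Rightarrow> ((nat \<Rightarrow> 'a::linordered_field) \<Rightarrow> 'a) \<Rightarrow> bool" for k where
  leaf: "affine_form k F \<Longrightarrow> piecewise_affine k F"
| branch: "\<lbrakk>affine_form k p; piecewise_affine k f; piecewise_affine k g;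
    \<And>x. 0 \<le> p x \<Longrightarrow> h x = f x; \<And>x. p x \<le> 0 \<Longrightarrow> h x = g x\<rbrakk> \<Longrightarrow> piecewise_affine k h"

lemma piecewise_affine_cong:
  assumes "piecewise_affine k f" "\<And>i. i < k \<Longrightarrow> x i = y i"
  shows "f x = f y"
  using assms
proof (induction arbitrary: x y)
  case (leaf F)
  then show ?case using affine_form_cong by blast
next
  case (branch p f g h)
  have "p x = p y"
    using affine_form_cong branch.hyps(1) branch.prems by blast
  then show ?case
    using branch by (metis linear)
qed

text \<open>The operation is pushed through the branches of \<open>f\<close>, then through those of
  \<open>g\<close>, until both arguments are affine.\<close>

lemma piecewise_affine_binop:
  assumes "piecewise_affine k f" "piecewise_affine k g"
    and "\<And>F G. affine_form k F \<Longrightarrow> affine_form k G \<Longrightarrow> piecewise_affine k (\<lambda>x. op (F x) (G x))"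
  shows "piecewise_affine k (\<lambda>x. op (f x) (g x))"
  using assms(1)
proof induction
  case (leaf F)
  show ?case
    using assms(2)
  proof induction
    case (leaf G)
    then show ?case using assms(3) \<open>affine_form k F\<close> by blast
  next
    case (branch p f g h)
    then show ?case
      by (intro piecewise_affine.branch[OF branch.hyps(1) branch.IH]) auto
  qed
next
  case (branch p f1 f2 h)
  then show ?case
    by (intro piecewise_affine.branch[OF branch.hyps(1) branch.IH]) auto
qed

lemma piecewise_affine_max:
  assumes "affine_form k F" "affine_form k G"
  shows "piecewise_affine k (\<lambda>x. max (F x) (G x))"
  by (rule branch[OF affine_form_diff[OF assms] leaf[OF assms(1)] leaf[OF assms(2)]]) auto

lemma piecewise_affine_min:
  assumes "affine_form k F" "affine_form k G"
  shows "piecewise_affine k (\<lambda>x. min (F x) (G x))"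
  by (rule branch[OF affine_form_diff[OF assms] leaf[OF assms(2)] leaf[OF assms(1)]]) auto

text \<open>The sum of the two constants serves on both sides, since \<open>f\<close> is
  nonnegative.\<close>

lemma linear_bound_cases:
  fixes f g p :: "'b \<Rightarrow> 'a::linordered_field"
  assumes "\<exists>n. 0 \<le> n \<and> (\<forall>x. R x \<and> 0 \<le> p x \<longrightarrow> g x \<le> n * f x)"
    and "\<exists>n. 0 \<le> n \<and> (\<forall>x. R x \<and> p x \<le> 0 \<longrightarrow> g x \<le> n * f x)"
    and nonneg: "\<And>x. R x \<Longrightarrow> 0 \<le> f x"
  shows "\<exists>n. 0 \<le> n \<and> (\<forall>x. R x \<longrightarrow> g x \<le> n * f x)"
proof -
  obtain m n where m: "0 \<le> m" "\<And>x. R x \<Longrightarrow> 0 \<le> p x \<Longrightarrow> g x \<le> m * f x"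
    and n: "0 \<le> n" "\<And>x. R x \<Longrightarrow> p x \<le> 0 \<Longrightarrow> g x \<le> n * f x"
    using assms(1,2) by auto
  have "g x \<le> (m + n) * f x" if "R x" for x
  proof -
    have "0 \<le> m * f x" "0 \<le> n * f x"
      using m(1) n(1) nonneg[OF that] by simp_all
    then show ?thesis
      using m(2)[OF that] n(2)[OF that] linear[of 0 "p x"] unfolding distrib_right by fastforce
  qed
  then show ?thesis
    using m(1) n(1) by (intro exI[of _ "m + n"]) simp
qed

text \<open>The sign condition of each branch joins the constraints in \<open>P\<close>. The leaves
  are then compared on closed polyhedra by \<open>affine_zero_set_bound\<close>, and
  \<open>linear_bound_cases\<close> merges the bounds.\<close>

theorem piecewise_affine_zero_set_bound:
  assumes "piecewise_affine k f" "piecewise_affine k g" "finite P" "\<And>p. p \<in> P \<Longrightarrow> affine_form k p"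
    and "\<And>x. (\<forall>p\<in>P. 0 \<le> p x) \<Longrightarrow> 0 \<le> f x \<and> g x \<le> 1 \<and> (f x = 0 \<longrightarrow> g x \<le> 0)"
  shows "\<exists>n. 0 \<le> n \<and> (\<forall>x. (\<forall>p\<in>P. 0 \<le> p x) \<longrightarrow> g x \<le> n * f x)"
  using assms
proof (induction arbitrary: P)
  case (leaf F)
  note F = leaf(1)
  show ?case
    using leaf(2-)
  proof (induction arbitrary: P)
    case (leaf G)
    then show ?case using affine_zero_set_bound[OF _ _ F] by blast
  next
    case (branch p g1 g2 g)
    note sat = branch.prems(3)
    have "\<exists>n. 0 \<le> n \<and> (\<forall>x. (\<forall>q\<in>insert p P. 0 \<le> q x) \<longrightarrow> g1 x \<le> n * F x)"
    proof (rule branch.IH(1))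
      fix x assume "\<forall>q\<in>insert p P. 0 \<le> q x"
      then have P: "\<forall>q\<in>P. 0 \<le> q x" and "0 \<le> p x"
        by simp_all
      then have "g x = g1 x"
        using branch.hyps(4) by simp
      then show "0 \<le> F x \<and> g1 x \<le> 1 \<and> (F x = 0 \<longrightarrow> g1 x \<le> 0)"
        using sat[OF P] by simp
    qed (use branch.prems branch.hyps(1) in auto)
    moreover have "\<exists>n. 0 \<le> n \<and> (\<forall>x. (\<forall>q\<in>insert (\<lambda>x. - p x) P. 0 \<le> q x) \<longrightarrow> g2 x \<le> n * F x)"
    proof (rule branch.IH(2))
      fix x assume "\<forall>q\<in>insert (\<lambda>x. - p x) P. 0 \<le> q x"
      then have P: "\<forall>q\<in>P. 0 \<le> q x" and "p x \<le> 0"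
        by simp_all
      then have "g x = g2 x"
        using branch.hyps(5) by simp
      then show "0 \<le> F x \<and> g2 x \<le> 1 \<and> (F x = 0 \<longrightarrow> g2 x \<le> 0)"
        using sat[OF P] by simp
    qed (use branch.prems affine_form_uminus[OF branch.hyps(1)] in auto)
    ultimately show ?case
      by (intro linear_bound_cases[of "\<lambda>x. \<forall>q\<in>P. 0 \<le> q x" p]) (auto simp: branch.hyps(4,5) sat)
  qed
next
  case (branch p f1 f2 f)
  note sat = branch.prems(4)
  have "\<exists>n. 0 \<le> n \<and> (\<forall>x. (\<forall>q\<in>insert p P. 0 \<le> q x) \<longrightarrow> g x \<le> n * f1 x)"
  proof (rule branch.IH(1))
    fix x assume "\<forall>q\<in>insert p P. 0 \<le> q x"
    then have P: "\<forall>q\<in>P. 0 \<le> q x" and "0 \<le> p x"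
      by simp_all
    then have "f x = f1 x"
      using branch.hyps(4) by simp
    then show "0 \<le> f1 x \<and> g x \<le> 1 \<and> (f1 x = 0 \<longrightarrow> g x \<le> 0)"
      using sat[OF P] by simp
  qed (use branch.prems branch.hyps(1) in auto)
  moreover have "\<exists>n. 0 \<le> n \<and> (\<forall>x. (\<forall>q\<in>insert (\<lambda>x. - p x) P. 0 \<le> q x) \<longrightarrow> g x \<le> n * f2 x)"
  proof (rule branch.IH(2))
    fix x assume "\<forall>q\<in>insert (\<lambda>x. - p x) P. 0 \<le> q x"
    then have P: "\<forall>q\<in>P. 0 \<le> q x" and "p x \<le> 0"
      by simp_all
    then have "f x = f2 x"
      using branch.hyps(5) by simp
    then show "0 \<le> f2 x \<and> g x \<le> 1 \<and> (f2 x = 0 \<longrightarrow> g x \<le> 0)"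
      using sat[OF P] by simp
  qed (use branch.prems affine_form_uminus[OF branch.hyps(1)] in auto)
  ultimately show ?case
    by (intro linear_bound_cases[of "\<lambda>x. \<forall>q\<in>P. 0 \<le> q x" p]) (auto simp: branch.hyps(4,5) sat)
qed

section \<open>Rational evaluation of MV-terms\<close>

text \<open>The record includes the constants so that \<open>bl_eval\<close> and
  \<open>fm_eval\<close> both apply. Its points are rational, hence expressible by constants of the
  language.\<close>

definition rational_mv :: "rat rmv" where
  "rational_mv = \<lparr> carrier = {0..1}, mult = luk_mult, one = 1, bl_meet = min, bl_join = max,
     bl_imp = luk_imp, bl_zero = 0, rmv_const = Rep_unit_rat \<rparr>"

lemma rational_mv_simps [simp]:
  "mult rational_mv = luk_mult" "one rational_mv = 1" "bl_meet rational_mv = min"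
  "bl_join rational_mv = max" "bl_imp rational_mv = luk_imp" "bl_zero rational_mv = 0"
  "rmv_const rational_mv = Rep_unit_rat"
  by (simp_all add: rational_mv_def)

lemma standard_mv_simps [simp]:
  "mult standard_mv = luk_mult" "one standard_mv = 1" "bl_meet standard_mv = min"
  "bl_join standard_mv = max" "bl_imp standard_mv = luk_imp" "bl_zero standard_mv = 0"
  "carrier standard_mv = {0..1}"
  by (simp_all add: standard_mv_def)

lemma Rep_unit_rat_bounds: "0 \<le> Rep_unit_rat q" "Rep_unit_rat q \<le> 1"
  using Rep_unit_rat[of q] by auto

lemma Rep_Abs_unit_rat: "0 \<le> r \<Longrightarrow> r \<le> 1 \<Longrightarrow> Rep_unit_rat (Abs_unit_rat r) = r"
  by (simp add: Abs_unit_rat_inverse)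

lemma bl_eval_rational_mv_bounds:
  assumes "\<And>i. 0 \<le> v i \<and> v i \<le> 1"
  shows "0 \<le> bl_eval rational_mv v t" "bl_eval rational_mv v t \<le> 1"
proof -
  have "0 \<le> bl_eval rational_mv v t \<and> bl_eval rational_mv v t \<le> 1"
    by (induction t) (auto simp: assms luk_mult_def luk_imp_def)
  then show "0 \<le> bl_eval rational_mv v t" "bl_eval rational_mv v t \<le> 1" by auto
qed

text \<open>A term has finitely many variables, so every large \<open>k\<close> works; the eventual
  form gives two terms a common \<open>k\<close> without computing one.\<close>

lemma piecewise_affine_bl_eval:
  "\<forall>\<^sub>F k in sequentially. piecewise_affine k (\<lambda>v. bl_eval rational_mv v t)"
proof -
  have op: "\<forall>\<^sub>F k in sequentially. piecewise_affine k (\<lambda>v. op (f v) (g v))"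
    if "\<forall>\<^sub>F k in sequentially. piecewise_affine k f" "\<forall>\<^sub>F k in sequentially. piecewise_affine k g"
      "\<And>k F G. affine_form k F \<Longrightarrow> affine_form k G \<Longrightarrow> piecewise_affine k (\<lambda>x. op (F x) (G x))"
    for op :: "rat \<Rightarrow> rat \<Rightarrow> rat" and f g
    using that(1,2) by eventually_elim (rule piecewise_affine_binop[OF _ _ that(3)])
  have mult: "piecewise_affine k (\<lambda>x. luk_mult (F x) (G x))"
    and imp: "piecewise_affine k (\<lambda>x. luk_imp (F x) (G x))"
    if "affine_form k F" "affine_form k G" for k F and G :: "_ \<Rightarrow> rat"
    unfolding luk_mult_def luk_imp_def
    by (intro piecewise_affine_max piecewise_affine_min affine_form_diff affine_form_add
        affine_form_const that)+
  show ?thesis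
  proof (induction t)
    case (TVar i)
    show ?case
      using eventually_gt_at_top[of i] by eventually_elim (simp add: leaf affine_form_var)
  next
    case (TMeet s t)
    then show ?case using op[OF _ _ piecewise_affine_min] by simp
  next
    case (TJoin s t)
    then show ?case using op[OF _ _ piecewise_affine_max] by simp
  next
    case (TMult s t)
    then show ?case using op[OF _ _ mult] by simp
  next
    case (TImp s t)
    then show ?case using op[OF _ _ imp] by simp
  qed (simp_all add: leaf affine_form_const)
qed

section \<open>Passage from rational to real valuations\<close>

lemma bl_eval_of_rat:
  "bl_eval standard_mv (\<lambda>i. of_rat (v i)) t = of_rat (bl_eval rational_mv v t)"
proof -
  have "(of_rat (max p q) :: real) = max (of_rat p) (of_rat q)"
    and "(of_rat (min p q) :: real) = min (of_rat p) (of_rat q)" for p q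
    by (simp_all add: max_def min_def of_rat_less_eq)
  then show ?thesis
    by (induction t) (simp_all add: luk_mult_def luk_imp_def of_rat_add of_rat_diff)
qed

lemma bl_eval_tendsto:
  assumes "\<And>i. (\<lambda>m. w m i) \<longlonglongrightarrow> v i"
  shows "(\<lambda>m. bl_eval standard_mv (w m) t) \<longlonglongrightarrow> bl_eval standard_mv v t"
  by (induction t) (auto simp: luk_mult_def luk_imp_def intro!: tendsto_intros tendsto_max tendsto_min assms)

text \<open>Rounding \<open>v\<close> down to a multiple of \<open>1 / (m + 1)\<close> keeps the
  approximations inside the unit interval.\<close>

lemma rational_approximation:
  fixes v :: real
  assumes "0 \<le> v" "v \<le> 1"
  shows "\<exists>q. (\<lambda>m. of_rat (q m)) \<longlonglongrightarrow> v \<and> (\<forall>m::nat. 0 \<le> q m \<and> q m \<le> 1)"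
proof -
  define q where "q m = (of_int \<lfloor>v * real (Suc m)\<rfloor> / of_nat (Suc m) :: rat)" for m
  have q: "of_rat (q m) = of_int \<lfloor>v * real (Suc m)\<rfloor> / real (Suc m)" for m
    by (simp add: q_def of_rat_divide del: of_nat_Suc)
  have bounds: "v - 1 / real (Suc m) \<le> of_rat (q m)" "of_rat (q m) \<le> v" for m
  proof -
    have "v * real (Suc m) - 1 \<le> of_int \<lfloor>v * real (Suc m)\<rfloor>"
      "of_int \<lfloor>v * real (Suc m)\<rfloor> \<le> v * real (Suc m)"
      by linarith+
    from this[THEN divide_right_mono, of "real (Suc m)"]
    show "v - 1 / real (Suc m) \<le> of_rat (q m)" "of_rat (q m) \<le> v"
      unfolding q by (simp_all add: diff_divide_distrib divide_le_eq del: of_nat_Suc)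
  qed
  have "(\<lambda>m. v - 1 / real (Suc m)) \<longlonglongrightarrow> v - 0"
    by (intro tendsto_diff tendsto_const LIMSEQ_Suc lim_1_over_n)
  then have "(\<lambda>m. of_rat (q m)) \<longlonglongrightarrow> v"
    unfolding diff_0_right
    by (rule tendsto_sandwich[OF always_eventually always_eventually _ tendsto_const, rotated 2])
      (blast intro: bounds)+
  moreover have "0 \<le> q m \<and> q m \<le> 1" for m
  proof -
    have "\<lfloor>v * real (Suc m)\<rfloor> \<le> \<lfloor>1 * real (Suc m)\<rfloor>"
      using assms by (intro floor_mono mult_right_mono) auto
    then have "\<lfloor>v * real (Suc m)\<rfloor> \<le> int (Suc m)"
      by simp
    then have "(of_int \<lfloor>v * real (Suc m)\<rfloor> :: rat) \<le> of_int (int (Suc m))"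
      using of_int_le_iff by blast
    moreover have "0 \<le> \<lfloor>v * real (Suc m)\<rfloor>"
      using assms by simp
    ultimately show ?thesis
      unfolding q_def by (simp add: divide_le_eq del: of_nat_Suc)
  qed
  ultimately show ?thesis by blast
qed

text \<open>Terms are continuous and have the same values at rational points in both algebras, so
  the equation passes to the limit.\<close>

lemma bl_identity_standard_mv_from_rational:
  assumes "\<And>v. (\<And>i. 0 \<le> v i \<and> v i \<le> 1) \<Longrightarrow> bl_eval rational_mv v t = 1"
  shows "bl_identity standard_mv t TOne"
  unfolding bl_identity_def
proof (intro allI impI)
  fix v :: "nat \<Rightarrow> real" assume "range v \<subseteq> carrier standard_mv"
  then have "0 \<le> v i \<and> v i \<le> 1" for i
    using atLeastAtMost_iff by (auto simp: image_subset_iff)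
  then have "\<forall>i. \<exists>q. (\<lambda>m. of_rat (q m)) \<longlonglongrightarrow> v i \<and> (\<forall>m::nat. 0 \<le> q m \<and> q m \<le> 1)"
    using rational_approximation by blast
  from choice[OF this] obtain w where
    w: "\<And>i. (\<lambda>m. of_rat (w i m)) \<longlonglongrightarrow> v i" "\<And>i m. 0 \<le> w i m \<and> w i m \<le> 1"
    by blast
  have "(\<lambda>m. bl_eval standard_mv (\<lambda>i. of_rat (w i m)) t) \<longlonglongrightarrow> bl_eval standard_mv v t"
    using bl_eval_tendsto[of "\<lambda>m i. of_rat (w i m)" v] w(1) by blast
  moreover have "bl_eval standard_mv (\<lambda>i. of_rat (w i m)) t = 1" for m
    using bl_eval_of_rat[of "\<lambda>i. w i m"] assms[of "\<lambda>i. w i m"] w(2) by simp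
  ultimately show "bl_eval standard_mv v t = bl_eval standard_mv v TOne"
    by (simp add: LIMSEQ_const_iff)
qed

text \<open>Each implication from \<open>s\<close> adds the nonnegative amount \<open>1 - s\<close>,
  so truncating at every step or once at the end is the same.\<close>

lemma bl_eval_rational_mv_funpow_imp:
  assumes "\<And>i. 0 \<le> v i \<and> v i \<le> 1"
  shows "bl_eval rational_mv v ((TImp s ^^ n) t) =
    min 1 (of_nat n * (1 - bl_eval rational_mv v s) + bl_eval rational_mv v t)"
proof (induction n)
  case 0
  then show ?case using bl_eval_rational_mv_bounds[OF assms] by simp
next
  case (Suc n)
  have "bl_eval rational_mv v s \<le> 1"
    by (rule bl_eval_rational_mv_bounds[OF assms])
  then show ?case
    by (simp add: Suc luk_imp_def algebra_simps min_def)
qed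

text \<open>The inequality \<open>1 - t \<le> n (1 - s)\<close> between piecewise affine functions is the identity
  \<open>s \<rightarrow> (s \<rightarrow> \<dots> (s \<rightarrow> t)) = 1\<close>.\<close>

lemma rational_entailment_identity:
  assumes entails: "\<And>v. (\<And>i. 0 \<le> v i \<and> v i \<le> 1) \<Longrightarrow> bl_eval rational_mv v s = 1 \<Longrightarrow>
    bl_eval rational_mv v t = 1"
  shows "\<exists>n. bl_identity standard_mv ((TImp s ^^ n) t) TOne"
proof -
  let ?s = "\<lambda>v. bl_eval rational_mv v s" and ?t = "\<lambda>v. bl_eval rational_mv v t"
  obtain k where k: "piecewise_affine k ?s" "piecewise_affine k ?t"
    using eventually_happens[OF eventually_conj[OF piecewise_affine_bl_eval piecewise_affine_bl_eval]]
    by auto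
  \<comment> \<open>The unit cube in the first \<open>k\<close> coordinates.\<close>
  define P where "P = (\<lambda>i v. v i :: rat) ` {..<k} \<union> (\<lambda>i v. 1 - v i) ` {..<k}"
  have P: "(\<forall>p\<in>P. 0 \<le> p v) \<longleftrightarrow> (\<forall>i<k. 0 \<le> v i \<and> v i \<le> 1)" for v
    by (simp add: P_def ball_Un) blast
  have "piecewise_affine k (\<lambda>v. 1 - ?s v)" "piecewise_affine k (\<lambda>v. 1 - ?t v)"
    using piecewise_affine_binop[OF leaf[OF affine_form_const, of k "1::rat"], where op = "(-)"] k
    by (auto intro: leaf affine_form_diff)
  moreover have "finite P"
    by (simp add: P_def)
  moreover have "affine_form k p" if "p \<in> P" for p
    using that unfolding P_def by (auto intro!: affine_form_var affine_form_diff affine_form_const)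
  moreover have "0 \<le> 1 - ?s v \<and> 1 - ?t v \<le> 1 \<and> (1 - ?s v = 0 \<longrightarrow> 1 - ?t v \<le> 0)"
    if "\<forall>p\<in>P. 0 \<le> p v" for v
  proof -
    \<comment> \<open>\<open>P\<close> leaves the coordinates from \<open>k\<close> on free. Setting
      them to 0 changes neither value and yields a valuation in the unit interval.\<close>
    define w where "w i = (if i < k then v i else 0)" for i
    have w: "0 \<le> w i \<and> w i \<le> 1" for i
      using that unfolding P w_def by auto
    have "?s v = ?s w" "?t v = ?t w"
      by (rule piecewise_affine_cong[OF k(1)] piecewise_affine_cong[OF k(2)], simp add: w_def)+
    then show ?thesis
      using bl_eval_rational_mv_bounds[of w s, OF w] bl_eval_rational_mv_bounds[of w t, OF w]
        entails[of w, OF w]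
      by auto
  qed
  ultimately obtain r where r: "0 \<le> r" "\<And>v. \<forall>p\<in>P. 0 \<le> p v \<Longrightarrow> 1 - ?t v \<le> r * (1 - ?s v)"
    using piecewise_affine_zero_set_bound[of k "\<lambda>v. 1 - ?s v" "\<lambda>v. 1 - ?t v" P] by blast
  \<comment> \<open>The number of implications is natural; enlarging the factor is harmless because
    \<open>1 - s\<close> is nonnegative.\<close>
  obtain n where n: "r \<le> of_nat n"
    using real_arch_simple by blast
  have "bl_eval rational_mv v ((TImp s ^^ n) t) = 1" if v: "\<And>i. 0 \<le> v i \<and> v i \<le> 1" for v
  proof -
    have "1 - ?t v \<le> r * (1 - ?s v)"
      using r(2) v P by blast
    also have "\<dots> \<le> of_nat n * (1 - ?s v)"
      using n bl_eval_rational_mv_bounds[OF v] by (intro mult_right_mono) auto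
    finally show ?thesis
      by (simp add: bl_eval_rational_mv_funpow_imp[OF v])
  qed
  then show ?thesis
    using bl_identity_standard_mv_from_rational by blast
qed

section \<open>Transfer to MV-algebras\<close>

lemma bl_le_zero_one:
  assumes "bl_algebra A" "a \<in> carrier A"
  shows "bl_meet A a (one A) = a" "bl_meet A (bl_zero A) a = bl_zero A"
  using assms unfolding bl_algebra_def bl_bounded_lattice_def bl_le_def by blast+

lemma bl_carrier:
  assumes "bl_algebra A"
  shows "one A \<in> carrier A" "bl_zero A \<in> carrier A"
    "\<lbrakk>a \<in> carrier A; b \<in> carrier A\<rbrakk> \<Longrightarrow> bl_imp A a b \<in> carrier A"
  using assms unfolding bl_algebra_def bl_bounded_lattice_def by blast+

lemma bl_meet_eq:
  assumes "bl_algebra A" "a \<in> carrier A" "b \<in> carrier A"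
  shows "bl_meet A a b = mult A a (bl_imp A a b)" "bl_meet A a b = bl_meet A b a"
  using assms unfolding bl_algebra_def bl_bounded_lattice_def by blast+

text \<open>Divisibility gives \<open>1 \<sqinter> a = 1 \<cdot> (1 \<rightarrow> a)\<close>, and
  the left side is \<open>a\<close>.\<close>

lemma bl_imp_one_left:
  assumes A: "bl_algebra A" and a: "a \<in> carrier A"
  shows "bl_imp A (one A) a = a"
proof -
  interpret comm_monoid A
    using A unfolding bl_algebra_def by (elim conjE)
  have "a = bl_meet A (one A) a"
    using bl_le_zero_one[OF A a] bl_meet_eq(2)[OF A a bl_carrier(1)[OF A]] by simp
  also have "\<dots> = bl_imp A (one A) a"
    using bl_meet_eq(1)[OF A bl_carrier(1)[OF A] a] bl_carrier[OF A] a by simp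
  finally show ?thesis ..
qed

text \<open>The rational entailment yields an identity of iterated implications, which every
  MV-algebra inherits from the standard one. When \<open>s\<close> takes the value 1, these
  implications disappear by \<open>bl_imp_one_left\<close>.\<close>

lemma mv_rational_entailment:
  assumes A: "mv_algebra A" and v: "range v \<subseteq> carrier A"
    and t: "bl_eval A v t \<in> carrier A"
    and entails: "\<And>v. (\<And>i. 0 \<le> v i \<and> v i \<le> 1) \<Longrightarrow> bl_eval rational_mv v s = 1 \<Longrightarrow>
      bl_eval rational_mv v t = 1"
    and s: "bl_eval A v s = one A"
  shows "bl_eval A v t = one A"
proof -
  obtain n where "bl_identity standard_mv ((TImp s ^^ n) t) TOne"
    using rational_entailment_identity[of s t] entails by blast
  then have "bl_identity A ((TImp s ^^ n) t) TOne"
    using A by (simp add: mv_algebra_def)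
  then have "bl_eval A v ((TImp s ^^ n) t) = one A"
    using v by (simp add: bl_identity_def)
  moreover have "bl_eval A v ((TImp s ^^ n) t) = bl_eval A v t" for n
  proof (induction n)
    case (Suc n)
    then show ?case
      using A s t by (simp add: mv_algebra_def bl_imp_one_left)
  qed simp
  ultimately show ?thesis by simp
qed

section \<open>Elimination of the constants\<close>

primrec fm_consts :: "fm \<Rightarrow> unit_rat set" where
  "fm_consts (Var i) = {}"
| "fm_consts (Const q) = {q}"
| "fm_consts (Meet s t) = fm_consts s \<union> fm_consts t"
| "fm_consts (Join s t) = fm_consts s \<union> fm_consts t"
| "fm_consts (Mult s t) = fm_consts s \<union> fm_consts t"
| "fm_consts (Imp s t) = fm_consts s \<union> fm_consts t"
| "fm_consts Zero = {}"
| "fm_consts One = {}"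

lemma finite_fm_consts: "finite (fm_consts \<phi>)"
  by (induction \<phi>) auto

text \<open>With one \<open>N\<close> for all constants in play, a single variable standing for
  \<open>1/N\<close> can express them. Each constant contributes its denominator as a
  factor.\<close>

lemma common_denominator:
  assumes "finite C"
  shows "\<exists>N>0. \<forall>q\<in>C. of_nat N * Rep_unit_rat q \<in> \<nat>"
  using assms
proof induction
  case empty
  then show ?case by auto
next
  case (insert q C)
  then obtain N where N: "N > 0" "\<forall>q\<in>C. of_nat N * Rep_unit_rat q \<in> \<nat>"
    by blast
  obtain a b where ab: "Rep_unit_rat q = of_int a / of_int b" "b > 0"
    by (metis quotient_of_denom_pos quotient_of_div surj_pair)
  then have "a \<ge> 0"
    using Rep_unit_rat_bounds(1)[of q] by (simp add: zero_le_divide_iff)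
  then have "of_nat (nat b) * Rep_unit_rat q = of_nat (nat a)"
    using ab by simp
  then have "of_nat (N * nat b) * Rep_unit_rat q = of_nat (N * nat a)"
    by (simp add: mult.assoc)
  then have "of_nat (N * nat b) * Rep_unit_rat q \<in> \<nat>"
    by (metis of_nat_in_Nats)
  moreover have "of_nat (N * nat b) * Rep_unit_rat p \<in> \<nat>" if "p \<in> C" for p
    using Nats_mult[OF of_nat_in_Nats N(2)[rule_format, OF that], of "nat b"] by (simp add: mult_ac)
  ultimately show ?case
    using N(1) ab(2) by (intro exI[of _ "N * nat b"]) auto
qed

text \<open>The constants with denominator \<open>N\<close> become multiples (in the sense of the truncated sum
  \<open>\<not> x \<rightarrow> y\<close>) of the variable \<open>TVar 0\<close>, which stands for \<open>1/N\<close>.\<close>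

definition multiple_term :: "nat \<Rightarrow> bl_term" where
  "multiple_term n = (TImp (TImp (TVar 0) TZero) ^^ n) TZero"

text \<open>In the unit interval this takes the value 1 only at \<open>1/N\<close>: there
  \<open>\<not> x = (N - 1) x\<close>.\<close>

definition unit_fraction_term :: "nat \<Rightarrow> bl_term" where
  "unit_fraction_term N = TMeet (TImp (TImp (TVar 0) TZero) (multiple_term (N - 1)))
     (TImp (multiple_term (N - 1)) (TImp (TVar 0) TZero))"

text \<open>Variables shift by one to free \<open>TVar 0\<close>. For a common denominator
  \<open>N\<close>, the floor merely reads the integral value \<open>N * q\<close> as a natural
  number.\<close>

primrec eliminate_consts :: "nat \<Rightarrow> fm \<Rightarrow> bl_term" where
  "eliminate_consts N (Var i) = TVar (Suc i)"
| "eliminate_consts N (Const q) = multiple_term (nat \<lfloor>of_nat N * Rep_unit_rat q\<rfloor>)"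
| "eliminate_consts N (Meet s t) = TMeet (eliminate_consts N s) (eliminate_consts N t)"
| "eliminate_consts N (Join s t) = TJoin (eliminate_consts N s) (eliminate_consts N t)"
| "eliminate_consts N (Mult s t) = TMult (eliminate_consts N s) (eliminate_consts N t)"
| "eliminate_consts N (Imp s t) = TImp (eliminate_consts N s) (eliminate_consts N t)"
| "eliminate_consts N Zero = TZero"
| "eliminate_consts N One = TOne"

text \<open>Each implication from \<open>\<not> c\<close> adds \<open>1/N\<close>, without
  truncation as long as the sum is at most 1. The hypotheses are weak enough to cover both rational
  MV-algebras and \<open>rational_mv\<close>.\<close>

lemma bl_eval_multiple_term:
  assumes imp: "\<And>p q. bl_imp A (rmv_const A p) (rmv_const A q) = rmv_const A (ur_imp p q)"
    and zero: "rmv_const A ur_zero = bl_zero A"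
    and c: "Rep_unit_rat c = 1 / of_nat N" "w 0 = rmv_const A c"
    and N: "0 < N" and q: "Rep_unit_rat q = of_nat k / of_nat N"
  shows "bl_eval A w (multiple_term k) = rmv_const A q"
  using q
proof (induction k arbitrary: q)
  case 0
  then have "q = ur_zero"
    by (simp add: Rep_unit_rat_inject[symmetric] ur_zero.rep_eq)
  then show ?case by (simp add: multiple_term_def zero)
next
  case (Suc k)
  have k: "of_nat (Suc k) / of_nat N \<le> (1 :: rat)"
    using Suc.prems Rep_unit_rat_bounds(2)[of q] by simp
  then have "of_nat k / of_nat N \<le> (1 :: rat)"
    using N by (simp add: field_simps)
  then obtain p where p: "Rep_unit_rat p = of_nat k / of_nat N"
    using Rep_Abs_unit_rat[of "of_nat k / of_nat N"] by auto
  have "1 / of_nat N \<le> (1 :: rat)"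
    using N by (simp add: field_simps)
  then have "ur_imp (ur_imp c ur_zero) p = q"
    using Suc.prems p c k
    by (simp add: Rep_unit_rat_inject[symmetric] ur_imp.rep_eq ur_zero.rep_eq luk_imp_def
        add_divide_distrib)
  then show ?case
    using Suc.IH[OF p] c(2) by (simp add: multiple_term_def zero[symmetric] imp)
qed

lemma bl_eval_eliminate_consts:
  assumes imp: "\<And>p q. bl_imp A (rmv_const A p) (rmv_const A q) = rmv_const A (ur_imp p q)"
    and zero: "rmv_const A ur_zero = bl_zero A"
    and c: "Rep_unit_rat c = 1 / of_nat N" "w 0 = rmv_const A c"
    and N: "0 < N" "\<forall>q\<in>fm_consts \<phi>. of_nat N * Rep_unit_rat q \<in> \<nat>"
  shows "bl_eval A w (eliminate_consts N \<phi>) = fm_eval A (\<lambda>i. w (Suc i)) \<phi>"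
  using N(2)
proof (induction \<phi>)
  case (Const q)
  then obtain k where k: "of_nat N * Rep_unit_rat q = of_nat k"
    by (auto elim: Nats_cases)
  then have "Rep_unit_rat q = of_nat k / of_nat N"
    using N(1) by (simp add: field_simps)
  then show ?case
    using bl_eval_multiple_term[of A c N w q, OF imp zero c N(1)] k by simp
qed auto

text \<open>The value 1 forces \<open>1 - x = min 1 ((N - 1) * x)\<close> for
  \<open>x = w 0\<close>. Truncation would give \<open>x = 0\<close>, where the right side is 0 and
  not 1; hence \<open>N * x = 1\<close>.\<close>

lemma unit_fraction_term_rational:
  assumes w: "\<And>i. 0 \<le> w i \<and> w i \<le> 1" and "0 < N"
    and one: "bl_eval rational_mv w (unit_fraction_term N) = 1"
  shows "w 0 = 1 / of_nat N"
proof -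
  have mult: "bl_eval rational_mv w (multiple_term k) = min 1 (of_nat k * w 0)" for k
    using bl_eval_rational_mv_funpow_imp[of w k "TImp (TVar 0) TZero" TZero, OF w] w[of 0]
    by (simp add: multiple_term_def luk_imp_def)
  have "1 - w 0 = min 1 (of_nat (N - 1) * w 0)"
    using one w[of 0] by (auto simp: unit_fraction_term_def mult luk_imp_def min_def split: if_splits)
  then have "of_nat N * w 0 = 1"
    using w[of 0] \<open>0 < N\<close> by (auto simp: min_def of_nat_diff algebra_simps split: if_splits)
  then show ?thesis
    using \<open>0 < N\<close> by (simp add: field_simps)
qed

lemma unit_fraction_term_rmv:
  assumes A: "rmv_algebra A" and c: "Rep_unit_rat c = 1 / of_nat N" "w 0 = rmv_const A c" and N: "0 < N"
  shows "bl_eval A w (unit_fraction_term N) = one A"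
proof -
  have imp: "\<And>p q. bl_imp A (rmv_const A p) (rmv_const A q) = rmv_const A (ur_imp p q)"
    and zero: "rmv_const A ur_zero = bl_zero A" and one: "rmv_const A ur_one = one A"
    using A by (auto simp: rmv_algebra_def)
  have bl: "bl_algebra A"
    using A by (simp add: rmv_algebra_def mv_algebra_def)
  let ?d = "ur_imp c ur_zero"
  have "1 / of_nat N \<le> (1 :: rat)"
    using N by (simp add: field_simps)
  then have "Rep_unit_rat ?d = of_nat (N - 1) / of_nat N"
    using c(1) N by (simp add: ur_imp.rep_eq ur_zero.rep_eq luk_imp_def of_nat_diff diff_divide_distrib)
  then have "bl_eval A w (multiple_term (N - 1)) = rmv_const A ?d"
    by (rule bl_eval_multiple_term[of A c N w, OF imp zero c N])
  moreover have "ur_imp ?d ?d = ur_one"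
    by (simp add: Rep_unit_rat_inject[symmetric] ur_imp.rep_eq ur_one.rep_eq luk_imp_def)
  ultimately show ?thesis
    using bl_le_zero_one[OF bl bl_carrier(1)[OF bl]]
    by (simp add: unit_fraction_term_def c(2) zero[symmetric] imp one)
qed

text \<open>Constants become terms in a fresh variable, and \<open>unit_fraction_term\<close> is
  added to the premise. At rational points this forces the variable to be \<open>1/N\<close>, so
  terms and formulas agree; in \<open>A\<close> it holds when the variable denotes the constant for
  \<open>1/N\<close>. Then \<open>mv_rational_entailment\<close> applies.\<close>

theorem rmv_rational_entailment:
  assumes A: "rmv_algebra A" and v: "range v \<subseteq> carrier A"
    and entails: "\<And>u. fm_eval rational_mv (\<lambda>i. Rep_unit_rat (u i)) \<delta> = 1 \<Longrightarrow>
      fm_eval rational_mv (\<lambda>i. Rep_unit_rat (u i)) \<phi> = 1"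
    and \<delta>: "fm_eval A v \<delta> = one A"
  shows "fm_eval A v \<phi> = one A"
proof -
  obtain N where N: "0 < N" "\<forall>q\<in>fm_consts \<delta> \<union> fm_consts \<phi>. of_nat N * Rep_unit_rat q \<in> \<nat>"
    using common_denominator[of "fm_consts \<delta> \<union> fm_consts \<phi>"] finite_fm_consts by auto
  have "1 / of_nat N \<le> (1 :: rat)"
    using N by (simp add: field_simps)
  then obtain c where c: "Rep_unit_rat c = 1 / of_nat N"
    using Rep_Abs_unit_rat[of "1 / of_nat N"] by auto
  define w where "w = case_nat (rmv_const A c) v"
  have imp: "\<And>p q. bl_imp A (rmv_const A p) (rmv_const A q) = rmv_const A (ur_imp p q)"
    and zero: "rmv_const A ur_zero = bl_zero A" and mv: "mv_algebra A"
    using A by (auto simp: rmv_algebra_def)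
  have bl: "bl_algebra A"
    using mv by (simp add: mv_algebra_def)
  have w0: "w 0 = rmv_const A c" and w_Suc: "(\<lambda>i. w (Suc i)) = v"
    by (simp_all add: w_def)
  have w: "range w \<subseteq> carrier A"
    using v rmv_closed(3)[OF A] by (auto simp: w_def image_subset_iff split: nat.split)
  have elim: "bl_eval A w (eliminate_consts N \<chi>) = fm_eval A v \<chi>"
    if "\<chi> \<in> {\<delta>, \<phi>}" for \<chi>
    using bl_eval_eliminate_consts[of A c N w \<chi>, OF imp zero c w0 N(1)] N(2) that w_Suc by auto
  have "bl_eval A w (eliminate_consts N \<phi>) = one A"
  proof (rule mv_rational_entailment[OF mv w])
    show "bl_eval A w (eliminate_consts N \<phi>) \<in> carrier A"
      using elim[of \<phi>] fm_eval_closed[OF A v] by simp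
    show "bl_eval A w (TMeet (unit_fraction_term N) (eliminate_consts N \<delta>)) = one A"
      using elim[of \<delta>] \<delta> unit_fraction_term_rmv[of A c N w, OF A c w0 N(1)]
        bl_le_zero_one(1)[OF bl bl_carrier(1)[OF bl]] by simp
  next
    fix x :: "nat \<Rightarrow> rat"
    assume x: "\<And>i. 0 \<le> x i \<and> x i \<le> 1"
      and "bl_eval rational_mv x (TMeet (unit_fraction_term N) (eliminate_consts N \<delta>)) = 1"
    then have 1: "bl_eval rational_mv x (unit_fraction_term N) = 1"
      "bl_eval rational_mv x (eliminate_consts N \<delta>) = 1"
      using bl_eval_rational_mv_bounds(2)[of x "unit_fraction_term N", OF x]
        bl_eval_rational_mv_bounds(2)[of x "eliminate_consts N \<delta>", OF x]
      by (auto simp: min_def split: if_splits)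
    have x0: "x 0 = rmv_const rational_mv c"
      using unit_fraction_term_rational[of x N, OF x N(1) 1(1)] c by simp
    have elim: "bl_eval rational_mv x (eliminate_consts N \<chi>) = fm_eval rational_mv (\<lambda>i. x (Suc i)) \<chi>"
      if "\<chi> \<in> {\<delta>, \<phi>}" for \<chi>
      using bl_eval_eliminate_consts[of rational_mv c N x \<chi>, OF _ _ c x0 N(1)] N(2) that
      by (auto simp: ur_imp.rep_eq ur_zero.rep_eq)
    have "(\<lambda>i. x (Suc i)) = (\<lambda>i. Rep_unit_rat (Abs_unit_rat (x (Suc i))))"
      using x by (simp add: Rep_Abs_unit_rat)
    then show "bl_eval rational_mv x (eliminate_consts N \<phi>) = 1"
      using entails[of "\<lambda>i. Abs_unit_rat (x (Suc i))"] elim 1(2) by simp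
  qed
  then show ?thesis
    using elim by simp
qed

text \<open>The axioms compute products and implications of constants. Meets reduce to these by
  divisibility, and joins by the identity
  \<open>x \<squnion> y = (x \<rightarrow> y) \<rightarrow> y\<close> of MV-algebras.\<close>

lemma fm_eval_rmv_const:
  assumes A: "rmv_algebra A"
  shows "fm_eval A (\<lambda>i. rmv_const A (u i)) \<phi> =
      rmv_const A (Abs_unit_rat (fm_eval rational_mv (\<lambda>i. Rep_unit_rat (u i)) \<phi>))"
proof -
  have imp: "\<And>p q. bl_imp A (rmv_const A p) (rmv_const A q) = rmv_const A (ur_imp p q)"
    and mult: "\<And>p q. mult A (rmv_const A p) (rmv_const A q) = rmv_const A (ur_mult p q)"
    and zero: "rmv_const A ur_zero = bl_zero A" and one: "rmv_const A ur_one = one A"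
    and mv: "mv_algebra A"
    using A by (auto simp: rmv_algebra_def)
  have const: "rmv_const A q \<in> carrier A" for q
    by (rule rmv_closed(3)[OF A])
  have meet: "bl_meet A (rmv_const A p) (rmv_const A q) = rmv_const A (ur_mult p (ur_imp p q))" for p q
    using bl_meet_eq(1)[OF _ const const] mv by (simp add: imp mult mv_algebra_def)
  have join: "bl_join A (rmv_const A p) (rmv_const A q) = rmv_const A (ur_imp (ur_imp p q) q)" for p q
  proof -
    let ?x = "TVar 0" and ?y = "TVar (Suc 0)"
    have "bl_identity standard_mv (TJoin ?x ?y) (TImp (TImp ?x ?y) ?y)"
      unfolding bl_identity_def
    proof (intro allI impI)
      fix v :: "nat \<Rightarrow> real" assume "range v \<subseteq> carrier standard_mv"
      then have "v i \<in> {0..1}" for i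
        by (simp add: image_subset_iff)
      from this[of 0] this[of 1]
      show "bl_eval standard_mv v (TJoin ?x ?y) = bl_eval standard_mv v (TImp (TImp ?x ?y) ?y)"
        by (auto simp: luk_imp_def min_def max_def)
    qed
    then have "bl_identity A (TJoin ?x ?y) (TImp (TImp ?x ?y) ?y)"
      using mv by (simp add: mv_algebra_def)
    then show ?thesis
      using const
      by (auto simp: bl_identity_def imp split: nat.splits
          dest!: spec[of _ "case_nat (rmv_const A p) (\<lambda>_. rmv_const A q)"])
  qed
  have "\<exists>r. Rep_unit_rat r = fm_eval rational_mv (\<lambda>i. Rep_unit_rat (u i)) \<phi> \<and>
      fm_eval A (\<lambda>i. rmv_const A (u i)) \<phi> = rmv_const A r"
  proof (induction \<phi>)
    case (Meet s t)
    then obtain p q where "Rep_unit_rat p = fm_eval rational_mv (\<lambda>i. Rep_unit_rat (u i)) s"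
      "Rep_unit_rat q = fm_eval rational_mv (\<lambda>i. Rep_unit_rat (u i)) t"
      "fm_eval A (\<lambda>i. rmv_const A (u i)) s = rmv_const A p"
      "fm_eval A (\<lambda>i. rmv_const A (u i)) t = rmv_const A q" by blast
    then show ?case
      using Rep_unit_rat_bounds[of p] Rep_unit_rat_bounds[of q]
      by (intro exI[of _ "ur_mult p (ur_imp p q)"])
        (auto simp: meet ur_mult.rep_eq ur_imp.rep_eq luk_mult_def luk_imp_def min_def max_def)
  next
    case (Join s t)
    then obtain p q where "Rep_unit_rat p = fm_eval rational_mv (\<lambda>i. Rep_unit_rat (u i)) s"
      "Rep_unit_rat q = fm_eval rational_mv (\<lambda>i. Rep_unit_rat (u i)) t"
      "fm_eval A (\<lambda>i. rmv_const A (u i)) s = rmv_const A p"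
      "fm_eval A (\<lambda>i. rmv_const A (u i)) t = rmv_const A q" by blast
    then show ?case
      using Rep_unit_rat_bounds[of p] Rep_unit_rat_bounds[of q]
      by (intro exI[of _ "ur_imp (ur_imp p q) q"])
        (auto simp: join ur_mult.rep_eq ur_imp.rep_eq luk_mult_def luk_imp_def min_def max_def)
  next
    case (Mult s t)
    then show ?case by (metis fm_eval.simps(5) mult rational_mv_simps(1) ur_mult.rep_eq)
  next
    case (Imp s t)
    then show ?case by (metis fm_eval.simps(6) imp rational_mv_simps(5) ur_imp.rep_eq)
  next
    case Zero
    then show ?case by (metis fm_eval.simps(7) zero rational_mv_simps(6) ur_zero.rep_eq)
  next
    case One
    then show ?case by (metis fm_eval.simps(8) one rational_mv_simps(2) ur_one.rep_eq)
  qed auto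
  then show ?thesis
    by (metis Rep_unit_rat_inverse)
qed

text \<open>The powers of a constant below 1 decrease to 0.\<close>

lemma rmv_trivial_if_const_eq_one:
  assumes A: "rmv_algebra A" and r: "Rep_unit_rat r < 1" "rmv_const A r = one A"
    and a: "a \<in> carrier A"
  shows "a = one A"
proof -
  have mult: "\<And>p q. mult A (rmv_const A p) (rmv_const A q) = rmv_const A (ur_mult p q)"
    and zero: "rmv_const A ur_zero = bl_zero A" and one: "rmv_const A ur_one = one A"
    and bl: "bl_algebra A"
    using A by (auto simp: rmv_algebra_def mv_algebra_def)
  interpret comm_monoid A
    using bl unfolding bl_algebra_def by (elim conjE)
  \<comment> \<open>\<open>q\<close> is the \<open>n\<close>-th power of \<open>r\<close> in the
    unit interval.\<close>
  have *: "\<exists>q. Rep_unit_rat q = max 0 (1 - of_nat n * (1 - Rep_unit_rat r)) \<and> rmv_const A q = one A" for n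
  proof (induction n)
    case 0
    then show ?case using one by (intro exI[of _ ur_one]) (simp add: ur_one.rep_eq)
  next
    case (Suc n)
    then obtain q where "Rep_unit_rat q = max 0 (1 - of_nat n * (1 - Rep_unit_rat r))"
      "rmv_const A q = one A" by blast
    then show ?case
      using mult[of q r] r
      by (intro exI[of _ "ur_mult q r"]) (auto simp: ur_mult.rep_eq luk_mult_def algebra_simps max_def)
  qed
  obtain n where "1 < of_nat n * (1 - Rep_unit_rat r)"
    using ex_less_of_nat_mult[of "1 - Rep_unit_rat r" 1] r(1) by auto
  then obtain q where "Rep_unit_rat q = 0" "rmv_const A q = one A"
    using *[of n] by (auto simp: max_def)
  then have "bl_zero A = one A"
    by (metis Rep_unit_rat_inject ur_zero.rep_eq zero)
  then show ?thesis
    using bl_le_zero_one[OF bl a] bl_meet_eq(2)[OF bl a bl_carrier(1)[OF bl]] by simp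
qed

section \<open>Separation by constant substitutions\<close>

text \<open>A counterexample in some algebra gives one at rational points by
  \<open>rmv_rational_entailment\<close>. Its constants turn \<open>\<Delta>\<close> into theorems
  and \<open>\<phi>\<close> into a constant below 1, which equals 1 only in trivial
  algebras.\<close>

theorem separating_substitution:
  assumes "finite \<Delta>" "\<not> rmv_consequence \<Delta> \<phi>"
  shows "\<exists>\<sigma>. (\<forall>\<delta>\<in>\<Delta>. rmv_consequence {} (fm_subst \<sigma> \<delta>)) \<and>
    (\<forall>\<chi>. rmv_consequence {fm_subst \<sigma> \<phi>} \<chi>)"
proof -
  obtain A :: "real rmv" and v where A: "rmv_algebra A" "range v \<subseteq> carrier A"
    "\<forall>\<delta>\<in>\<Delta>. fm_eval A v \<delta> = one A" "fm_eval A v \<phi> \<noteq> one A"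
    using assms(2) by (auto simp: rmv_consequence_def rmv_valid_def)
  have bl: "bl_algebra A"
    using A(1) by (simp add: rmv_algebra_def mv_algebra_def)
  obtain ds where ds: "set ds = \<Delta>"
    using assms(1) finite_list by blast
  \<comment> \<open>The entailment theorem takes a single premise, so \<open>\<Delta>\<close> is
    replaced by its meet.\<close>
  define \<delta> where "\<delta> = foldr Meet ds One"
  have "fm_eval A v (foldr Meet xs One) = one A" if "set xs \<subseteq> \<Delta>" for xs
    using that A(3) bl_le_zero_one(1)[OF bl bl_carrier(1)[OF bl]] by (induction xs) auto
  then have "fm_eval A v \<delta> = one A"
    by (simp add: \<delta>_def ds)
  then obtain u where u: "fm_eval rational_mv (\<lambda>i. Rep_unit_rat (u i)) \<delta> = 1"
    "fm_eval rational_mv (\<lambda>i. Rep_unit_rat (u i)) \<phi> \<noteq> 1"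
    using rmv_rational_entailment[OF A(1,2), of \<delta> \<phi>] A(4) by blast
  let ?e = "\<lambda>\<chi>. fm_eval rational_mv (\<lambda>i. Rep_unit_rat (u i)) \<chi>"
  have e: "0 \<le> ?e \<chi> \<and> ?e \<chi> \<le> 1" for \<chi>
    by (induction \<chi>) (auto simp: luk_mult_def luk_imp_def Rep_unit_rat_bounds)
  have "\<forall>\<delta>\<in>set xs. ?e \<delta> = 1" if "?e (foldr Meet xs One) = 1" for xs
    using that
  proof (induction xs)
    case (Cons x xs)
    then show ?case
      using e[of x] e[of "foldr Meet xs One"] by (auto simp: min_def split: if_splits)
  qed simp
  then have e\<Delta>: "\<forall>\<delta>\<in>\<Delta>. ?e \<delta> = 1"
    using u(1) ds by (auto simp: \<delta>_def)
  define \<sigma> where "\<sigma> = (\<lambda>i. Const (u i))"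
  have \<sigma>: "fm_eval B w (fm_subst \<sigma> \<chi>) = rmv_const B (Abs_unit_rat (?e \<chi>))"
    if "rmv_algebra B" for B :: "real rmv" and w \<chi>
    by (simp add: fm_eval_subst \<sigma>_def fm_eval_rmv_const[OF that])
  have "rmv_consequence {} (fm_subst \<sigma> \<delta>)" if "\<delta> \<in> \<Delta>" for \<delta>
    using e\<Delta> that by (auto simp: rmv_consequence_def rmv_valid_def \<sigma> rmv_algebra_def ur_one_def[symmetric])
  moreover have "rmv_consequence {fm_subst \<sigma> \<phi>} \<chi>" for \<chi>
    unfolding rmv_consequence_def rmv_valid_def
  proof (intro allI impI)
    fix B :: "real rmv" and w
    assume B: "rmv_algebra B" "range w \<subseteq> carrier B" "\<forall>\<delta>\<in>{fm_subst \<sigma> \<phi>}. fm_eval B w \<delta> = one B"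
    have "Rep_unit_rat (Abs_unit_rat (?e \<phi>)) < 1"
      using e[of \<phi>] u(2) by (simp add: Rep_Abs_unit_rat)
    then show "fm_eval B w \<chi> = one B"
      using B \<sigma>[OF B(1)] rmv_trivial_if_const_eq_one[OF B(1)] fm_eval_closed[OF B(1,2)] by simp
  qed
  ultimately show ?thesis by blast
qed

section \<open>Extensions and structural completeness\<close>

lemma consistent_extension_eq:
  assumes L: "extension_of L rational_luk" "consistent L"
  shows "L = rational_luk"
proof -
  have logic: "is_logic L" and ext: "\<And>\<Gamma> \<phi>. rational_luk \<Gamma> \<phi> \<Longrightarrow> L \<Gamma> \<phi>"
    using L(1) by (auto simp: extension_of_def)
  have cut: "L \<Gamma> \<phi>" if "\<forall>\<delta>\<in>\<Delta>. L \<Gamma> \<delta>" "L \<Delta> \<phi>" for \<Gamma> \<Delta> \<phi>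
    using logic that unfolding is_logic_def by meson
  have "rational_luk \<Gamma> \<phi>" if "L \<Gamma> \<phi>" for \<Gamma> \<phi>
  proof (rule ccontr)
    assume not: "\<not> rational_luk \<Gamma> \<phi>"
    obtain \<Delta> where \<Delta>: "finite \<Delta>" "\<Delta> \<subseteq> \<Gamma>" "L \<Delta> \<phi>"
      using logic \<open>L \<Gamma> \<phi>\<close> unfolding is_logic_def by meson
    then obtain \<sigma> where \<sigma>: "\<forall>\<delta>\<in>\<Delta>. rmv_consequence {} (fm_subst \<sigma> \<delta>)"
      "\<And>\<chi>. rmv_consequence {fm_subst \<sigma> \<phi>} \<chi>"
      using separating_substitution[of \<Delta> \<phi>] not by (auto simp: rational_luk_def)
    have "L (fm_subst \<sigma> ` \<Delta>) (fm_subst \<sigma> \<phi>)"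
      using logic \<Delta>(3) unfolding is_logic_def by meson
    moreover have "\<forall>\<delta>\<in>fm_subst \<sigma> ` \<Delta>. L {} \<delta>"
      using \<sigma>(1) by (auto intro!: ext simp: rational_luk_def)
    ultimately have "L {} (fm_subst \<sigma> \<phi>)"
      using cut by blast
    moreover have "L {fm_subst \<sigma> \<phi>} \<chi>" for \<chi>
      using \<sigma>(2) by (intro ext) (auto simp: rational_luk_def)
    ultimately have "L {} \<chi>" for \<chi>
      using cut[of "{fm_subst \<sigma> \<phi>}"] by blast
    then show False
      using L(2) by (simp add: consistent_def)
  qed
  then show ?thesis
    using ext by blast
qed

text \<open>For a rule that is admissible but not derivable, the separating substitution would
  produce a theorem that entails every formula, contrary to consistency.\<close>

lemma structurally_complete_rational_luk: "structurally_complete rational_luk"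
  unfolding structurally_complete_def derivable_def
proof (intro allI impI, rule ccontr)
  fix \<Gamma> \<phi> assume "finite \<Gamma>" and adm: "admissible rational_luk \<Gamma> \<phi>" and "\<not> rational_luk \<Gamma> \<phi>"
  then obtain \<sigma> where \<sigma>: "\<forall>\<delta>\<in>\<Gamma>. rmv_consequence {} (fm_subst \<sigma> \<delta>)"
    "\<And>\<chi>. rmv_consequence {fm_subst \<sigma> \<phi>} \<chi>"
    using separating_substitution[of \<Gamma> \<phi>] by (auto simp: rational_luk_def)
  then have "rmv_consequence {} (fm_subst \<sigma> \<phi>)"
    using adm by (auto simp: admissible_def rational_luk_def)
  then have "rmv_consequence {} \<chi>" for \<chi>
    using \<sigma>(2)[of \<chi>] by (auto simp: rmv_consequence_def rmv_valid_def)
  then show False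
    using consistent_rational_luk by (auto simp: consistent_def rational_luk_def)
qed

theorem theorem9p1:
  shows "(\<nexists>L. extension_of L rational_luk \<and> L \<noteq> rational_luk \<and> consistent L) \<and>
    hereditarily_structurally_complete rational_luk"
proof
  show "\<nexists>L. extension_of L rational_luk \<and> L \<noteq> rational_luk \<and> consistent L"
    using consistent_extension_eq by blast
  show "hereditarily_structurally_complete rational_luk"
    unfolding hereditarily_structurally_complete_def
  proof (intro allI impI)
    fix L assume L: "extension_of L rational_luk"
    show "structurally_complete L"
    proof (cases "consistent L")
      case True
      then show ?thesis
        using consistent_extension_eq[OF L] structurally_complete_rational_luk by simp
    next
      case False
      \<comment> \<open>In an inconsistent extension every formula is a theorem, so by monotonicity
        every rule is derivable.\<close>
      have "\<forall>\<Gamma> \<Delta> \<phi>. L \<Gamma> \<phi> \<longrightarrow> \<Gamma> \<subseteq> \<Delta> \<longrightarrow> L \<Delta> \<phi>"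
        using L unfolding extension_of_def is_logic_def by (elim conjE)
      then show ?thesis
        using False unfolding structurally_complete_def derivable_def consistent_def by blast
    qed
  qed
qed

end
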